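(* Let $d\in\mathbb N$, let $\varphi$ be the random dynamical system on $[0,1]^d$ generated by $\mathrm dX^i(t)=X^i(t)(1-X^i(t))\,\mathrm dW^i(t)$, $i=1,\dots,d$, and let $\bar\varphi(t,\omega)=(\varphi(t,\vartheta_{-t}\omega))^{-1}$ be its inverse flow, a random dynamical system over $(\bar\vartheta_t)_{t\in\mathbb R}$ with $\bar\vartheta_t=\vartheta_{-t}$ (see context). Then the minimal weak cc-attractor of $\bar\varphi$ on $[0,1]^d$ is given by $[0,1]^d$ itself.
   Context: RDS setting. A metric dynamical system (MDS) is a probability space $(\Omega,\mathcal F,\mathbb P)$ with a jointly measurable family of maps $(\vartheta_t)_{t\in\mathbb R}$ preserving $\mathbb P$, with $\vartheta_0=\mathrm{Id}$ and $\vartheta_{t+s}=\vartheta_t\circ\vartheta_s$. A (two-sided) random dynamical system (RDS) on a metric space $(E,\mathrm d)$ is an MDS together with a measurable map $\varphi:\mathbb R\times\Omega\times E\to E$, $(t,\omega,x)\mapsto\varphi(t,\omega)x$, with $\varphi(0,\omega)=\mathrm{Id}_E$ and $\varphi(t+s,\omega)=\varphi(t,\vartheta_s\omega)\circ\varphi(s,\omega)$. The system. $E=[0,1]^d$ with the metric $\mathrm d$ induced by the uniform norm; $(\Omega,\mathcal F,\mathbb P)$ is the $d$-dimensional two-sided Wiener space, $W=(W^1,\dots,W^d)$ the two-sided $d$-dimensional Wiener process, and $(\vartheta_t\omega)_s=\omega_{s+t}-\omega_t$ the Wiener shift. $\varphi$ is the two-sided RDS on $[0,1]^d$, jointly continuous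 in time and space, such that for $t\ge 0$, $t\mapsto\varphi(t,\cdot)x$ solves the Itô SDE $\mathrm dX^i(t)=X^i(t)(1-X^i(t))\,\mathrm dW^i(t)$, $i=1,\dots,d$, with $X(0)=x$. It acts coordinatewise, $\varphi(t,\omega)x=(\varphi^1(t,\omega)x^1,\dots,\varphi^d(t,\omega)x^d)$, each $\varphi^i(t,\omega)$ being an increasing bijection of $[0,1]$. The inverse flow $\bar\varphi(t,\omega)=(\varphi(t,\vartheta_{-t}\omega))^{-1}$ is an RDS on $[0,1]^d$ over the MDS $(\Omega,\mathcal F,\mathbb P,(\bar\vartheta_t)_{t\in\mathbb R})$, $\bar\vartheta_t=\vartheta_{-t}$, jointly continuous in time and space. Attractors (for an RDS $\psi$ over $(\theta_t)$). For nonempty $A,B\subseteq E$, $B$ bounded, $\mathrm d(A,B)=\sup_{x\in A}\inf_{y\in B}\mathrm d(x,y)$. A compact random set is a map $A$ from $\Omega$ to subsets of $E$ with $A(\omega)$ compact for each $\omega$ and $\omega\mapsto\mathrm d(x,A(\omega))$ measurable for each $x$; it is strictly $\psi$-invariant if for every $t$, $\psi(t,\omega)A(\omega)=A(\theta_t\omega)$ for $\mathbb P$-almost all $\omega$. A strictly $\psi$-invariant compact random set $A$ is a weak cc-attractor if for every nonempty countable compact set $C\subseteq E$, $\lim_{t\to\infty}\mathrm d(\psi(t,\omega)C,A(\theta_t\omega))=0$ in probability. It is minimal if it is contained ($\mathbb P$-almost surely) in any other weak cc-attractor. *)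

theory Defs
  imports "HOL-Probability.Probability"
begin

section \<open>Random dynamical systems\<close>

definition mds :: "'w measure \<Rightarrow> (real \<Rightarrow> 'w \<Rightarrow> 'w) \<Rightarrow> bool" where
  "mds M \<theta> \<longleftrightarrow>
     prob_space M \<and>
     (\<lambda>(t, \<omega>). \<theta> t \<omega>) \<in> borel \<Otimes>\<^sub>M M \<rightarrow>\<^sub>M M \<and>
     (\<forall>t. distr M M (\<theta> t) = M) \<and>
     (\<forall>\<omega>\<in>space M. \<theta> 0 \<omega> = \<omega>) \<and>
     (\<forall>s t. \<forall>\<omega>\<in>space M. \<theta> (t + s) \<omega> = \<theta> t (\<theta> s \<omega>))"

text \<open>State spaces are metric spaces in the sense of \<^locale>\<open>Metric_space\<close>: a carrier set
  together with an explicit distance function. This allows the uniform norm on the cube, whereas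
  the type class metric of \<open>real ^ 'n\<close> is the Euclidean one.\<close>

definition metric_borel :: "'a set \<Rightarrow> ('a \<Rightarrow> 'a \<Rightarrow> real) \<Rightarrow> 'a measure" where
  "metric_borel E d = sigma E {U. openin (Metric_space.mtopology E d) U}"

definition rds ::
    "'w measure \<Rightarrow> (real \<Rightarrow> 'w \<Rightarrow> 'w) \<Rightarrow> 'a set \<Rightarrow> ('a \<Rightarrow> 'a \<Rightarrow> real) \<Rightarrow>
     (real \<Rightarrow> 'w \<Rightarrow> 'a \<Rightarrow> 'a) \<Rightarrow> bool" where
  "rds M \<theta> E d \<psi> \<longleftrightarrow>
     mds M \<theta> \<and> Metric_space E d \<and>
     (\<lambda>(t, \<omega>, x). \<psi> t \<omega> x) \<in> borel \<Otimes>\<^sub>M (M \<Otimes>\<^sub>M metric_borel E d) \<rightarrow>\<^sub>M metric_borel E d \<and>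
     (\<forall>\<omega>\<in>space M. \<forall>x\<in>E. \<psi> 0 \<omega> x = x) \<and>
     (\<forall>s t. \<forall>\<omega>\<in>space M. \<forall>x\<in>E. \<psi> (t + s) \<omega> x = \<psi> t (\<theta> s \<omega>) (\<psi> s \<omega> x))"

definition jointly_continuous ::
    "'w measure \<Rightarrow> 'a set \<Rightarrow> ('a \<Rightarrow> 'a \<Rightarrow> real) \<Rightarrow> (real \<Rightarrow> 'w \<Rightarrow> 'a \<Rightarrow> 'a) \<Rightarrow> bool" where
  "jointly_continuous M E d \<psi> \<longleftrightarrow>
     (\<forall>\<omega>\<in>space M.
        continuous_map (prod_topology euclideanreal (Metric_space.mtopology E d))
          (Metric_space.mtopology E d) (\<lambda>(t, x). \<psi> t \<omega> x))"

definition inverse_flow ::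
    "'a set \<Rightarrow> (real \<Rightarrow> 'w \<Rightarrow> 'w) \<Rightarrow> (real \<Rightarrow> 'w \<Rightarrow> 'a \<Rightarrow> 'a) \<Rightarrow> real \<Rightarrow> 'w \<Rightarrow> 'a \<Rightarrow> 'a" where
  "inverse_flow E \<theta> \<psi> t \<omega> = inv_into E (\<psi> t (\<theta> (- t) \<omega>))"

section \<open>Weak attractors of countable compact sets\<close>

text \<open>Not symmetric. Only meaningful for nonempty sets, with bounded distances; all uses below
  are of this kind.\<close>

definition semidist :: "('a \<Rightarrow> 'a \<Rightarrow> real) \<Rightarrow> 'a set \<Rightarrow> 'a set \<Rightarrow> real" where
  "semidist d A B = (SUP x\<in>A. INF y\<in>B. d x y)"

text \<open>Nonemptiness of \<open>A \<omega>\<close> is implicit in the use of \<open>d(x, A \<omega>)\<close>.\<close>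

definition compact_random_set ::
    "'w measure \<Rightarrow> 'a set \<Rightarrow> ('a \<Rightarrow> 'a \<Rightarrow> real) \<Rightarrow> ('w \<Rightarrow> 'a set) \<Rightarrow> bool" where
  "compact_random_set M E d A \<longleftrightarrow>
     (\<forall>\<omega>\<in>space M. A \<omega> \<noteq> {} \<and> compactin (Metric_space.mtopology E d) (A \<omega>)) \<and>
     (\<forall>x\<in>E. (\<lambda>\<omega>. semidist d {x} (A \<omega>)) \<in> borel_measurable M)"

definition strictly_invariant ::
    "'w measure \<Rightarrow> (real \<Rightarrow> 'w \<Rightarrow> 'w) \<Rightarrow> (real \<Rightarrow> 'w \<Rightarrow> 'a \<Rightarrow> 'a) \<Rightarrow> ('w \<Rightarrow> 'a set) \<Rightarrow> bool" where
  "strictly_invariant M \<theta> \<psi> A \<longleftrightarrow> (\<forall>t. AE \<omega> in M. \<psi> t \<omega> ` A \<omega> = A (\<theta> t \<omega>))"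

definition tends_to_0_in_probability :: "'w measure \<Rightarrow> (real \<Rightarrow> 'w \<Rightarrow> real) \<Rightarrow> bool" where
  "tends_to_0_in_probability M Z \<longleftrightarrow>
     (\<forall>\<epsilon>>0. ((\<lambda>t. measure M {\<omega> \<in> space M. \<bar>Z t \<omega>\<bar> > \<epsilon>}) \<longlongrightarrow> 0) at_top)"

definition weak_cc_attractor ::
    "'w measure \<Rightarrow> (real \<Rightarrow> 'w \<Rightarrow> 'w) \<Rightarrow> 'a set \<Rightarrow> ('a \<Rightarrow> 'a \<Rightarrow> real) \<Rightarrow>
     (real \<Rightarrow> 'w \<Rightarrow> 'a \<Rightarrow> 'a) \<Rightarrow> ('w \<Rightarrow> 'a set) \<Rightarrow> bool" where
  "weak_cc_attractor M \<theta> E d \<psi> A \<longleftrightarrow>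
     compact_random_set M E d A \<and>
     strictly_invariant M \<theta> \<psi> A \<and>
     (\<forall>C. C \<noteq> {} \<and> countable C \<and> compactin (Metric_space.mtopology E d) C \<longrightarrow>
        tends_to_0_in_probability M (\<lambda>t \<omega>. semidist d (\<psi> t \<omega> ` C) (A (\<theta> t \<omega>))))"

definition minimal_weak_cc_attractor ::
    "'w measure \<Rightarrow> (real \<Rightarrow> 'w \<Rightarrow> 'w) \<Rightarrow> 'a set \<Rightarrow> ('a \<Rightarrow> 'a \<Rightarrow> real) \<Rightarrow>
     (real \<Rightarrow> 'w \<Rightarrow> 'a \<Rightarrow> 'a) \<Rightarrow> ('w \<Rightarrow> 'a set) \<Rightarrow> bool" where
  "minimal_weak_cc_attractor M \<theta> E d \<psi> A \<longleftrightarrow>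
     weak_cc_attractor M \<theta> E d \<psi> A \<and>
     (\<forall>A'. weak_cc_attractor M \<theta> E d \<psi> A' \<longrightarrow> (AE \<omega> in M. A \<omega> \<subseteq> A' \<omega>))"

section \<open>Two-sided Wiener space\<close>

text \<open>The canonical path space: continuous paths vanishing at \<open>0\<close>, with the \<open>\<sigma>\<close>-algebra generated
  by the evaluations (which is the Borel \<open>\<sigma>\<close>-algebra of locally uniform convergence). It is not
  completed, since the Wiener shift would then no longer be jointly measurable. The last two
  clauses determine the finite-dimensional distributions, hence \<open>M\<close>: all coordinate increments
  over consecutive time intervals, on either side of \<open>0\<close>, are independent centred Gaussians
  whose variance is the length of the interval.\<close>

definition wiener_paths :: "(real \<Rightarrow> real ^ 'n) set" where
  "wiener_paths = {\<omega>. continuous_on UNIV \<omega> \<and> \<omega> 0 = 0}"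

definition two_sided_wiener_space :: "(real \<Rightarrow> real ^ 'n) measure \<Rightarrow> bool" where
  "two_sided_wiener_space M \<longleftrightarrow>
     prob_space M \<and>
     sets M = sets (restrict_space (\<Pi>\<^sub>M t\<in>UNIV. borel) wiener_paths) \<and>
     (\<forall>s t i. s < t \<longrightarrow>
        distributed M lborel (\<lambda>\<omega>. (\<omega> t - \<omega> s) $ i) (\<lambda>x. ennreal (normal_density 0 (sqrt (t - s)) x))) \<and>
     (\<forall>n. \<forall>\<tau> :: nat \<Rightarrow> real. strict_mono_on {..n} \<tau> \<longrightarrow>
        prob_space.indep_vars M (\<lambda>_. borel) (\<lambda>(k, i) \<omega>. (\<omega> (\<tau> (Suc k)) - \<omega> (\<tau> k)) $ i)
          ({..<n} \<times> UNIV))"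

definition wiener_shift :: "real \<Rightarrow> (real \<Rightarrow> real ^ 'n) \<Rightarrow> real \<Rightarrow> real ^ 'n" where
  "wiener_shift t \<omega> = (\<lambda>s. \<omega> (s + t) - \<omega> t)"

text \<open>The filtration of \<open>(W\<^sub>t)\<close>, \<open>t \<ge> 0\<close>, augmented by the null sets.\<close>

definition wiener_filtration ::
    "(real \<Rightarrow> real ^ 'n) measure \<Rightarrow> real \<Rightarrow> (real \<Rightarrow> real ^ 'n) measure" where
  "wiener_filtration M t =
     sigma (space M)
       ({(\<lambda>\<omega>. \<omega> s) -` B \<inter> space M | s B. 0 \<le> s \<and> s \<le> t \<and> B \<in> sets borel} \<union> null_sets M)"

section \<open>Ito integral and stochastic differential equation\<close>

text \<open>An elementary process \<open>\<Sum>k<n. \<xi> k \<cdot> 1\<^bsub>(\<tau> k, \<tau> (k+1)]\<^esub>\<close> on \<open>[0, T]\<close>, adapted to the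
  filtration \<open>F\<close>, and its elementary integral with respect to \<open>B\<close>.\<close>

definition elementary_process ::
    "'w measure \<Rightarrow> (real \<Rightarrow> 'w measure) \<Rightarrow> real \<Rightarrow> nat \<Rightarrow> (nat \<Rightarrow> real) \<Rightarrow> (nat \<Rightarrow> 'w \<Rightarrow> real) \<Rightarrow> bool"
  where
  "elementary_process M F T n \<tau> \<xi> \<longleftrightarrow>
     0 \<le> \<tau> 0 \<and> mono_on {..n} \<tau> \<and> \<tau> n \<le> T \<and>
     (\<forall>k<n. \<xi> k \<in> borel_measurable (F (\<tau> k)) \<and> (\<exists>c. \<forall>\<omega>\<in>space M. \<bar>\<xi> k \<omega>\<bar> \<le> c))"

definition elementary_value ::
    "nat \<Rightarrow> (nat \<Rightarrow> real) \<Rightarrow> (nat \<Rightarrow> 'w \<Rightarrow> real) \<Rightarrow> real \<Rightarrow> 'w \<Rightarrow> real" where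
  "elementary_value n \<tau> \<xi> s \<omega> = (\<Sum>k<n. \<xi> k \<omega> * indicator {\<tau> k<..\<tau> (Suc k)} s)"

definition elementary_integral ::
    "(real \<Rightarrow> 'w \<Rightarrow> real) \<Rightarrow> nat \<Rightarrow> (nat \<Rightarrow> real) \<Rightarrow> (nat \<Rightarrow> 'w \<Rightarrow> real) \<Rightarrow> 'w \<Rightarrow> real" where
  "elementary_integral B n \<tau> \<xi> \<omega> = (\<Sum>k<n. \<xi> k \<omega> * (B (\<tau> (Suc k)) \<omega> - B (\<tau> k) \<omega>))"

text \<open>The square-integrable measurable adapted integrands on \<open>[0, T]\<close>.\<close>

definition ito_integrand ::
    "'w measure \<Rightarrow> (real \<Rightarrow> 'w measure) \<Rightarrow> real \<Rightarrow> (real \<Rightarrow> 'w \<Rightarrow> real) \<Rightarrow> bool" where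
  "ito_integrand M F T H \<longleftrightarrow>
     (\<lambda>(s, \<omega>). H s \<omega>) \<in> borel_measurable (restrict_space borel {0..T} \<Otimes>\<^sub>M M) \<and>
     (\<forall>s\<in>{0..T}. H s \<in> borel_measurable (F s)) \<and>
     (\<integral>\<^sup>+\<omega>. (\<integral>\<^sup>+s\<in>{0..T}. ennreal ((H s \<omega>)\<^sup>2) \<partial>lborel) \<partial>M) < \<infinity>"

text \<open>\<open>I\<close> is (a version of) the Ito integral of \<open>H\<close> over \<open>[0, T]\<close> with respect to the
  \<open>F\<close>-Brownian motion \<open>B\<close>: the mean-square limit of the elementary integrals of elementary
  processes approximating \<open>H\<close> in mean square. By the isometry, \<open>I\<close> is almost surely unique.\<close>

definition has_ito_integral ::
    "'w measure \<Rightarrow> (real \<Rightarrow> 'w measure) \<Rightarrow> (real \<Rightarrow> 'w \<Rightarrow> real) \<Rightarrow> real \<Rightarrow> (real \<Rightarrow> 'w \<Rightarrow> real) \<Rightarrow>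
     ('w \<Rightarrow> real) \<Rightarrow> bool" where
  "has_ito_integral M F B T H I \<longleftrightarrow>
     ito_integrand M F T H \<and> I \<in> borel_measurable M \<and>
     (\<exists>n \<tau> \<xi>.
        (\<forall>m :: nat. elementary_process M F T (n m) (\<tau> m) (\<xi> m)) \<and>
        (\<lambda>m. \<integral>\<^sup>+\<omega>. (\<integral>\<^sup>+s\<in>{0..T}. ennreal ((H s \<omega> - elementary_value (n m) (\<tau> m) (\<xi> m) s \<omega>)\<^sup>2) \<partial>lborel) \<partial>M)
          \<longlonglongrightarrow> 0 \<and>
        (\<lambda>m. \<integral>\<^sup>+\<omega>. ennreal ((I \<omega> - elementary_integral B (n m) (\<tau> m) (\<xi> m) \<omega>)\<^sup>2) \<partial>M) \<longlonglongrightarrow> 0)"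

text \<open>\<open>X\<close> solves \<open>dX(t) = \<sigma>(X(t)) dB(t)\<close>, \<open>t \<ge> 0\<close>, \<open>X(0) = x\<close>.\<close>

definition ito_solution ::
    "'w measure \<Rightarrow> (real \<Rightarrow> 'w measure) \<Rightarrow> (real \<Rightarrow> 'w \<Rightarrow> real) \<Rightarrow> (real \<Rightarrow> real) \<Rightarrow> real \<Rightarrow>
     (real \<Rightarrow> 'w \<Rightarrow> real) \<Rightarrow> bool" where
  "ito_solution M F B \<sigma> x X \<longleftrightarrow>
     (\<forall>\<omega>\<in>space M. continuous_on {0..} (\<lambda>t. X t \<omega>)) \<and>
     (\<forall>t\<ge>0. X t \<in> borel_measurable (F t)) \<and>
     (\<forall>t\<ge>0. \<exists>I. has_ito_integral M F B t (\<lambda>s \<omega>. \<sigma> (X s \<omega>)) I \<and> (AE \<omega> in M. X t \<omega> = x + I \<omega>))"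

section \<open>The system on the unit cube\<close>

definition unit_cube :: "(real ^ 'n) set" where
  "unit_cube = {x. \<forall>i. 0 \<le> x $ i \<and> x $ i \<le> 1}"

definition sup_dist :: "real ^ 'n \<Rightarrow> real ^ 'n \<Rightarrow> real" where
  "sup_dist x y = infnorm (x - y)"

definition solution_flow ::
    "(real \<Rightarrow> real ^ 'n) measure \<Rightarrow> (real \<Rightarrow> (real \<Rightarrow> real ^ 'n) \<Rightarrow> real ^ 'n \<Rightarrow> real ^ 'n) \<Rightarrow> bool" where
  "solution_flow M \<phi> \<longleftrightarrow>
     (\<forall>x\<in>unit_cube. \<forall>i.
        ito_solution M (wiener_filtration M) (\<lambda>t \<omega>. \<omega> t $ i) (\<lambda>u. u * (1 - u)) (x $ i)
          (\<lambda>t \<omega>. \<phi> t \<omega> x $ i))"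

definition coordinatewise_increasing ::
    "(real \<Rightarrow> real ^ 'n) measure \<Rightarrow> (real \<Rightarrow> (real \<Rightarrow> real ^ 'n) \<Rightarrow> real ^ 'n \<Rightarrow> real ^ 'n) \<Rightarrow> bool" where
  "coordinatewise_increasing M \<phi> \<longleftrightarrow>
     (\<forall>t. \<forall>\<omega>\<in>space M. \<exists>g :: 'n \<Rightarrow> real \<Rightarrow> real.
        (\<forall>i. strict_mono_on {0..1} (g i) \<and> bij_betw (g i) {0..1} {0..1}) \<and>
        (\<forall>x\<in>unit_cube. \<phi> t \<omega> x = (\<chi> i. g i (x $ i))))"

section \<open>Basic facts\<close>

lemma Metric_space_unit_cube: "Metric_space unit_cube sup_dist"
proof
  fix x y z :: "real ^ 'n"
  show "0 \<le> sup_dist x y" by (simp add: sup_dist_def infnorm_pos_le)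
  show "sup_dist x y = sup_dist y x" by (simp add: sup_dist_def infnorm_sub)
  show "(sup_dist x y = 0) = (x = y)" by (simp add: sup_dist_def infnorm_eq_0)
  show "sup_dist x z \<le> sup_dist x y + sup_dist y z"
    using infnorm_triangle[of "x - y" "y - z"] by (simp add: sup_dist_def)
qed

lemma space_metric_borel [simp]: "Metric_space E d \<Longrightarrow> space (metric_borel E d) = E"
  unfolding metric_borel_def
  by (rule space_measure_of) (metis (mono_tags, lifting) Metric_space.topspace_mtopology
      PowI mem_Collect_eq openin_subset subsetI)

lemma rds_maps_to:
  assumes "rds M \<theta> E d \<psi>" "\<omega> \<in> space M" "x \<in> E"
  shows "\<psi> t \<omega> x \<in> E"
proof -
  have "(t, \<omega>, x) \<in> space (borel \<Otimes>\<^sub>M (M \<Otimes>\<^sub>M metric_borel E d))"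
    using assms by (simp add: rds_def space_pair_measure)
  with assms(1) show ?thesis
    unfolding rds_def by (metis (mono_tags, lifting) case_prod_conv measurable_space space_metric_borel)
qed

lemma mds_space: "mds M \<theta> \<Longrightarrow> \<omega> \<in> space M \<Longrightarrow> \<theta> t \<omega> \<in> space M"
  unfolding mds_def
  using measurable_space[of "\<lambda>(t, \<omega>). \<theta> t \<omega>" "borel \<Otimes>\<^sub>M M" M "(t, \<omega>)"]
  by (auto simp: space_pair_measure)

lemma inverse_flow_eq:
  assumes r: "rds M \<theta> E d \<psi>" and w: "\<omega> \<in> space M" and y: "y \<in> E"
  shows "inverse_flow E \<theta> \<psi> t \<omega> y = \<psi> (- t) \<omega> y"
proof -
  define \<eta> where "\<eta> = \<theta> (- t) \<omega>"
  have m: "mds M \<theta>" using r by (simp add: rds_def)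
  have e: "\<eta> \<in> space M" using mds_space[OF m w] by (simp add: \<eta>_def)
  have ret: "\<theta> t \<eta> = \<omega>"
    using m w unfolding mds_def \<eta>_def by (metis add.right_inverse)
  have coc: "\<psi> (a + b) \<rho> x = \<psi> a (\<theta> b \<rho>) (\<psi> b \<rho> x)" if "\<rho> \<in> space M" "x \<in> E" for a b \<rho> x
    using r that unfolding rds_def by blast
  have id: "\<psi> 0 \<rho> x = x" if "\<rho> \<in> space M" "x \<in> E" for \<rho> x
    using r that unfolding rds_def by blast
  have 1: "\<psi> t \<eta> (\<psi> (- t) \<omega> y) = y"
    using coc[OF w y, of t "- t"] id[OF w y] by (simp add: \<eta>_def)
  have 2: "\<psi> (- t) \<omega> (\<psi> t \<eta> x) = x" if "x \<in> E" for x
    using coc[OF e that, of "- t" t] id[OF e that] ret by simp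
  have "inj_on (\<psi> t \<eta>) E" by (metis 2 inj_onI)
  then show ?thesis
    unfolding inverse_flow_def \<eta>_def[symmetric]
    using inv_into_f_f[OF _ rds_maps_to[OF r w y, of "- t"]] 1 by metis
qed

lemma rds_inverse_flow:
  assumes r: "rds M \<theta> E d \<psi>"
  shows "rds M (\<lambda>t. \<theta> (- t)) E d (inverse_flow E \<theta> \<psi>)"
proof -
  have m: "mds M \<theta>" and ms: "Metric_space E d" using r by (auto simp: rds_def)
  have m1[measurable]: "(\<lambda>(t, \<omega>). \<theta> t \<omega>) \<in> borel \<Otimes>\<^sub>M M \<rightarrow>\<^sub>M M"
    using m by (simp add: mds_def)
  have m2[measurable]:
    "(\<lambda>(t, \<omega>, x). \<psi> t \<omega> x) \<in> borel \<Otimes>\<^sub>M (M \<Otimes>\<^sub>M metric_borel E d) \<rightarrow>\<^sub>M metric_borel E d"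
    using r by (simp add: rds_def)
  have "(\<lambda>p. (- fst p, snd p)) \<in> borel \<Otimes>\<^sub>M M \<rightarrow>\<^sub>M (borel :: real measure) \<Otimes>\<^sub>M M" by measurable
  from measurable_compose[OF this m1]
  have 1: "(\<lambda>(t, \<omega>). \<theta> (- t) \<omega>) \<in> borel \<Otimes>\<^sub>M M \<rightarrow>\<^sub>M M" by (simp add: case_prod_beta)
  have mds': "mds M (\<lambda>t. \<theta> (- t))"
    unfolding mds_def
  proof (intro conjI allI ballI)
    show "\<theta> (- (t + s)) \<omega> = \<theta> (- t) (\<theta> (- s) \<omega>)" if "\<omega> \<in> space M" for s t \<omega>
      using m that unfolding mds_def by (metis minus_add_distrib)
  qed (use m 1 in \<open>auto simp: mds_def\<close>)
  have "(\<lambda>p. (- fst p, snd p)) \<in> borel \<Otimes>\<^sub>M (M \<Otimes>\<^sub>M metric_borel E d)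
          \<rightarrow>\<^sub>M (borel :: real measure) \<Otimes>\<^sub>M (M \<Otimes>\<^sub>M metric_borel E d)" by measurable
  from measurable_compose[OF this m2]
  have 2: "(\<lambda>(t, \<omega>, x). \<psi> (- t) \<omega> x) \<in> borel \<Otimes>\<^sub>M (M \<Otimes>\<^sub>M metric_borel E d) \<rightarrow>\<^sub>M metric_borel E d"
    by (simp add: case_prod_beta)
  have 3: "(\<lambda>(t, \<omega>, x). inverse_flow E \<theta> \<psi> t \<omega> x)
             \<in> borel \<Otimes>\<^sub>M (M \<Otimes>\<^sub>M metric_borel E d) \<rightarrow>\<^sub>M metric_borel E d"
    by (rule measurable_cong[THEN iffD2, OF _ 2])
       (auto simp: space_pair_measure ms inverse_flow_eq[OF r])
  have 4: "inverse_flow E \<theta> \<psi> (t + s) \<omega> x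
             = inverse_flow E \<theta> \<psi> t (\<theta> (- s) \<omega>) (inverse_flow E \<theta> \<psi> s \<omega> x)"
    if "\<omega> \<in> space M" "x \<in> E" for s t \<omega> x
  proof -
    have "\<psi> (- t + - s) \<omega> x = \<psi> (- t) (\<theta> (- s) \<omega>) (\<psi> (- s) \<omega> x)"
      using r that unfolding rds_def by blast
    then show ?thesis
      using that by (simp add: inverse_flow_eq[OF r] mds_space[OF m] rds_maps_to[OF r])
  qed
  have 5: "inverse_flow E \<theta> \<psi> 0 \<omega> x = x" if "\<omega> \<in> space M" "x \<in> E" for \<omega> x
    using that r inverse_flow_eq[OF r that, of 0] unfolding rds_def by simp
  show ?thesis
    unfolding rds_def using mds' ms 3 4 5 by blast
qed

end

theory Submission
  imports Defs
begin

text \<open>The cube attracts all of its subsets and is mapped onto itself, so the content is minimality: every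
weak cc-attractor \<open>A\<close> contains the cube almost surely. It suffices that \<open>A\<close> almost surely comes within any
given distance of any given point \<open>p\<close>, since \<open>A\<close> is closed and the cube is separable.

Enclose \<open>p\<close> in a small box with lower corner \<open>a\<close> and upper corner \<open>b\<close>. The forward flow \<open>\<phi>\<close> maps this box
onto the box with corners \<open>\<phi>(t)a\<close> and \<open>\<phi>(t)b\<close>. Each coordinate \<open>X\<close> of a trajectory is its
initial value plus a stochastic integral and takes values in \<open>[0, 1]\<close>; hence by the Ito isometry the
expectation of the integral of \<open>(X(1 - X))\<^sup>2\<close> over all times is finite (\<open>ito_solution_energy\<close>), and there
are arbitrarily late times at which all coordinates of the images of both corners are close to \<open>0\<close> or \<open>1\<close> with high probability (\<open>flow_leaves_interior\<close>). At each such time the two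
trajectories are still distinct in every coordinate, by strict monotonicity of the flow, so with high probability their coordinate gaps
exceed some deterministic positive number.

A countable compact set can be as dense near the ends of \<open>[0, 1]\<close> as one likes, as long as its points
accumulate only there. Choose a sequence \<open>t n\<close> of such times and then a countable compact subset of
\<open>[0, 1]\<close>, containing \<open>1/2\<close>, whose spacing near the ends is finer than the gap at time \<open>t n\<close>
(\<open>accumulating_grid\<close>). Let \<open>C\<close> consist of the vectors with coordinates in that subset. Then \<open>C\<close> meets the
image box at time \<open>t n\<close> with probability tending to 1
(\<open>ex_countable_compact_set_hitting_box\<close>). Equivalently, the inverse flow carries a point of \<open>C\<close> into the
box around \<open>p\<close>. As \<open>A\<close> attracts \<open>C\<close> and the shift preserves the measure, \<open>A\<close> comes close to \<open>p\<close> with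
probability 1 (\<open>attractor_near_point_if_hit\<close>).\<close>

section \<open>The Ito isometry\<close>

lemma Int_stable_vimage_sets: "Int_stable {f -` A \<inter> S |A. A \<in> sets N}"
  unfolding Int_stable_def
proof safe
  fix A B assume "A \<in> sets N" "B \<in> sets N"
  then show "\<exists>C. f -` A \<inter> S \<inter> (f -` B \<inter> S) = f -` C \<inter> S \<and> C \<in> sets N"
    by (intro exI[of _ "A \<inter> B"]) auto
qed

text \<open>The Ito isometry uses only that \<open>B\<close> is adapted to \<open>F\<close> and that its increments are centred Gaussians
  independent of the past. Keeping \<open>F\<close> abstract matters: each coordinate of the Wiener process is a
  Brownian motion with respect to the filtration of the whole process, which is larger than its own.\<close>

locale filtered_brownian_motion = prob_space M for M :: "'w measure" +
  fixes F :: "real \<Rightarrow> 'w measure" and B :: "real \<Rightarrow> 'w \<Rightarrow> real"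
  assumes subalgebra_F: "subalgebra M (F t)"
    and mono_F: "s \<le> t \<Longrightarrow> sets (F s) \<subseteq> sets (F t)"
    and adapted_B: "0 \<le> t \<Longrightarrow> B t \<in> borel_measurable (F t)"
    and distributed_increment: "0 \<le> s \<Longrightarrow> s < t \<Longrightarrow>
      distributed M lborel (\<lambda>\<omega>. B t \<omega> - B s \<omega>) (\<lambda>x. ennreal (normal_density 0 (sqrt (t - s)) x))"
    and indep_increment: "0 \<le> s \<Longrightarrow> s < t \<Longrightarrow>
      indep_set (sets (F s)) {(\<lambda>\<omega>. B t \<omega> - B s \<omega>) -` A \<inter> space M | A. A \<in> sets borel}"
begin

lemma measurable_F_mono:
  assumes "f \<in> borel_measurable (F s)" "s \<le> t"
  shows "f \<in> borel_measurable (F t)"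
  using assms mono_F[of s t] subalgebra_F[of s] subalgebra_F[of t]
  by (auto simp: measurable_def subalgebra_def)

lemma indep_var_increment:
  assumes "0 \<le> s" "s < t" and Z: "Z \<in> borel_measurable (F s)"
  shows "indep_var borel Z borel (\<lambda>\<omega>. B t \<omega> - B s \<omega>)"
proof -
  let ?D = "\<lambda>\<omega>. B t \<omega> - B s \<omega>"
  have sub: "{Z -` A \<inter> space M |A. A \<in> sets borel} \<subseteq> sets (F s)"
    using measurable_sets[OF Z] subalgebra_F[of s] by (auto simp: subalgebra_def)
  have "indep_set {Z -` A \<inter> space M |A. A \<in> sets borel} {?D -` A \<inter> space M |A. A \<in> sets borel}"
    using indep_setD[OF indep_increment[OF assms(1,2)]] sub
      indep_setD_ev1[OF indep_increment[OF assms(1,2)]] indep_setD_ev2[OF indep_increment[OF assms(1,2)]]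
    by (intro indep_setI) (blast, blast, blast)
  from indep_set_sigma_sets[OF this Int_stable_vimage_sets Int_stable_vimage_sets] show ?thesis
    using measurable_from_subalg[OF subalgebra_F Z] adapted_B[of s] adapted_B[of t] assms
      measurable_from_subalg[OF subalgebra_F]
    by (auto simp: indep_var_eq intro!: borel_measurable_diff)
qed

lemma increment_moments:
  assumes "0 \<le> s" "s \<le> t"
  shows "integrable M (\<lambda>\<omega>. B t \<omega> - B s \<omega>)"
    and "expectation (\<lambda>\<omega>. B t \<omega> - B s \<omega>) = 0"
    and "integrable M (\<lambda>\<omega>. (B t \<omega> - B s \<omega>)\<^sup>2)"
    and "expectation (\<lambda>\<omega>. (B t \<omega> - B s \<omega>)\<^sup>2) = t - s"
proof -
  let ?D = "\<lambda>\<omega>. B t \<omega> - B s \<omega>"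
  have "integrable M ?D \<and> expectation ?D = 0 \<and> integrable M (\<lambda>\<omega>. (?D \<omega>)\<^sup>2) \<and>
        expectation (\<lambda>\<omega>. (?D \<omega>)\<^sup>2) = t - s"
  proof (cases "s < t")
    case True
    note dist = distributed_increment[OF assms(1) True]
    have pos: "0 < sqrt (t - s)" using True by simp
    have m: "(\<lambda>x. x) \<in> borel_measurable lborel" "(\<lambda>x::real. x\<^sup>2) \<in> borel_measurable lborel"
      by simp_all
    note mom = normal_moment_even[OF pos, of 0 1]
    have sq: "has_bochner_integral lborel (\<lambda>x. normal_density 0 (sqrt (t - s)) x * x\<^sup>2) (t - s)"
    proof -
      have "fact (2 * 1) / ((2 / (sqrt (t - s))\<^sup>2) ^ 1 * fact 1) = t - s"
        using True by (simp add: fact_numeral field_simps)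
      from mom[unfolded this] show ?thesis by simp
    qed
    have 1: "integrable M ?D"
      using distributed_integrable[OF dist m(1)] integrable_normal_moment_nz_1[OF pos, of 0] by simp
    have 2: "expectation ?D = 0"
      using distributed_integral[OF dist m(1)] integral_normal_moment_nz_1[OF pos, of 0] by simp
    have 3: "integrable M (\<lambda>\<omega>. (?D \<omega>)\<^sup>2)"
      using distributed_integrable[OF dist m(2)] sq by (simp add: has_bochner_integral_iff)
    have 4: "expectation (\<lambda>\<omega>. (?D \<omega>)\<^sup>2) = t - s"
      using distributed_integral[OF dist m(2)] sq by (simp add: has_bochner_integral_iff)
    show ?thesis using 1 2 3 4 by blast
  next
    case False
    then show ?thesis using assms by simp
  qed
  then show "integrable M ?D" "expectation ?D = 0" "integrable M (\<lambda>\<omega>. (?D \<omega>)\<^sup>2)"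
    "expectation (\<lambda>\<omega>. (?D \<omega>)\<^sup>2) = t - s" by auto
qed

lemma integral_mult_increment:
  assumes st: "0 \<le> s" "s \<le> t" and Z: "Z \<in> borel_measurable (F s)" "integrable M Z"
  shows "integrable M (\<lambda>\<omega>. Z \<omega> * (B t \<omega> - B s \<omega>))"
    and "expectation (\<lambda>\<omega>. Z \<omega> * (B t \<omega> - B s \<omega>)) = 0"
proof -
  let ?D = "\<lambda>\<omega>. B t \<omega> - B s \<omega>"
  have "integrable M (\<lambda>\<omega>. Z \<omega> * ?D \<omega>) \<and> expectation (\<lambda>\<omega>. Z \<omega> * ?D \<omega>) = 0"
  proof (cases "s < t")
    case True
    note ind = indep_var_increment[OF st(1) True Z(1)]
    show ?thesis
      using indep_var_integrable[OF ind Z(2) increment_moments(1)[OF st]]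
        indep_var_lebesgue_integral[OF ind Z(2) increment_moments(1)[OF st]]
        increment_moments(2)[OF st] by simp
  qed (use st in simp)
  then show "integrable M (\<lambda>\<omega>. Z \<omega> * ?D \<omega>)" "expectation (\<lambda>\<omega>. Z \<omega> * ?D \<omega>) = 0" by auto
qed

lemma integral_mult_increment_square:
  assumes st: "0 \<le> s" "s \<le> t" and Z: "Z \<in> borel_measurable (F s)" "integrable M (\<lambda>\<omega>. (Z \<omega>)\<^sup>2)"
  shows "integrable M (\<lambda>\<omega>. (Z \<omega>)\<^sup>2 * (B t \<omega> - B s \<omega>)\<^sup>2)"
    and "expectation (\<lambda>\<omega>. (Z \<omega>)\<^sup>2 * (B t \<omega> - B s \<omega>)\<^sup>2) = expectation (\<lambda>\<omega>. (Z \<omega>)\<^sup>2) * (t - s)"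
proof -
  let ?D = "\<lambda>\<omega>. B t \<omega> - B s \<omega>"
  have "integrable M (\<lambda>\<omega>. (Z \<omega>)\<^sup>2 * (?D \<omega>)\<^sup>2) \<and>
        expectation (\<lambda>\<omega>. (Z \<omega>)\<^sup>2 * (?D \<omega>)\<^sup>2) = expectation (\<lambda>\<omega>. (Z \<omega>)\<^sup>2) * (t - s)"
  proof (cases "s < t")
    case True
    have ind: "indep_var borel (\<lambda>\<omega>. (Z \<omega>)\<^sup>2) borel (\<lambda>\<omega>. (?D \<omega>)\<^sup>2)"
      using indep_var_compose[OF indep_var_increment[OF st(1) True Z(1)],
          of "\<lambda>x. x\<^sup>2" borel "\<lambda>x. x\<^sup>2" borel] by (simp add: comp_def)
    show ?thesis
      using indep_var_integrable[OF ind Z(2) increment_moments(3)[OF st]]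
        indep_var_lebesgue_integral[OF ind Z(2) increment_moments(3)[OF st]]
        increment_moments(4)[OF st] by simp
  qed (use st in simp)
  then show "integrable M (\<lambda>\<omega>. (Z \<omega>)\<^sup>2 * (?D \<omega>)\<^sup>2)"
    "expectation (\<lambda>\<omega>. (Z \<omega>)\<^sup>2 * (?D \<omega>)\<^sup>2) = expectation (\<lambda>\<omega>. (Z \<omega>)\<^sup>2) * (t - s)" by auto
qed

lemma integrable_bounded_square:
  fixes f :: "'w \<Rightarrow> real"
  assumes "f \<in> borel_measurable M" and bdd: "\<exists>c. \<forall>\<omega>\<in>space M. \<bar>f \<omega>\<bar> \<le> c"
  shows "integrable M (\<lambda>\<omega>. (f \<omega>)\<^sup>2)"
proof -
  obtain c where c: "\<And>\<omega>. \<omega> \<in> space M \<Longrightarrow> \<bar>f \<omega>\<bar> \<le> c" using bdd by blast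
  have "(f \<omega>)\<^sup>2 \<le> c\<^sup>2" if "\<omega> \<in> space M" for \<omega>
    using c[OF that] by (metis abs_ge_zero power2_abs power_mono)
  then show ?thesis
    using assms(1) by (intro integrable_const_bound[where B="c\<^sup>2"] AE_I2) auto
qed

lemma elementary_process_step:
  assumes "elementary_process M F T (Suc n) \<tau> \<xi>"
  shows "elementary_process M F (\<tau> n) n \<tau> \<xi>" "0 \<le> \<tau> n" "\<tau> n \<le> \<tau> (Suc n)" "\<tau> (Suc n) \<le> T"
    "\<xi> n \<in> borel_measurable (F (\<tau> n))" "\<exists>c. \<forall>\<omega>\<in>space M. \<bar>\<xi> n \<omega>\<bar> \<le> c"
proof -
  have m: "mono_on {..Suc n} \<tau>" and "0 \<le> \<tau> 0" using assms by (auto simp: elementary_process_def)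
  show "0 \<le> \<tau> n" "\<tau> n \<le> \<tau> (Suc n)"
    using mono_onD[OF m, of 0 n] mono_onD[OF m, of n "Suc n"] \<open>0 \<le> \<tau> 0\<close> by auto
  show "elementary_process M F (\<tau> n) n \<tau> \<xi>"
    using assms mono_on_subset[OF m, of "{..n}"] by (auto simp: elementary_process_def)
qed (use assms in \<open>auto simp: elementary_process_def\<close>)

text \<open>Adding one more summand \<open>\<xi> n * \<Delta>\<close> to the integral \<open>S\<close> changes the second moment by
  \<open>E[(\<xi> n)\<^sup>2] * (\<tau> (n + 1) - \<tau> n)\<close> alone: the cross term \<open>2 * S * \<xi> n * \<Delta>\<close> has mean zero because
  \<open>S * \<xi> n\<close> is known at time \<open>\<tau> n\<close> and \<open>\<Delta>\<close> is independent of that past. Measurability of \<open>S\<close> with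
  respect to \<open>F (\<tau> n)\<close> is part of the claim so that the induction can use it.\<close>

lemma elementary_integral_moments:
  assumes "elementary_process M F T n \<tau> \<xi>"
  defines "S \<equiv> elementary_integral B n \<tau> \<xi>"
  shows "S \<in> borel_measurable (F (\<tau> n)) \<and> integrable M (\<lambda>\<omega>. (S \<omega>)\<^sup>2) \<and>
    expectation (\<lambda>\<omega>. (S \<omega>)\<^sup>2) = (\<Sum>k<n. expectation (\<lambda>\<omega>. (\<xi> k \<omega>)\<^sup>2) * (\<tau> (Suc k) - \<tau> k))"
  using assms(1) unfolding S_def
proof (induction n arbitrary: T)
  case 0
  then show ?case by (simp add: elementary_integral_def)
next
  case (Suc n)
  note st = elementary_process_step[OF Suc.prems]
  let ?S = "elementary_integral B n \<tau> \<xi>" and ?D = "\<lambda>\<omega>. B (\<tau> (Suc n)) \<omega> - B (\<tau> n) \<omega>"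
  from Suc.IH[OF st(1)] have IH: "?S \<in> borel_measurable (F (\<tau> n))" "integrable M (\<lambda>\<omega>. (?S \<omega>)\<^sup>2)"
    "expectation (\<lambda>\<omega>. (?S \<omega>)\<^sup>2) = (\<Sum>k<n. expectation (\<lambda>\<omega>. (\<xi> k \<omega>)\<^sup>2) * (\<tau> (Suc k) - \<tau> k))"
    by auto
  obtain c where c: "\<And>\<omega>. \<omega> \<in> space M \<Longrightarrow> \<bar>\<xi> n \<omega>\<bar> \<le> c" using st(6) by blast
  have SM: "?S \<in> borel_measurable M" and xM: "\<xi> n \<in> borel_measurable M"
    using measurable_from_subalg[OF subalgebra_F] IH(1) st(5) by blast+
  have x2: "integrable M (\<lambda>\<omega>. (\<xi> n \<omega>)\<^sup>2)"
    by (rule integrable_bounded_square[OF xM st(6)])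
  have Sx: "integrable M (\<lambda>\<omega>. ?S \<omega> * \<xi> n \<omega>)"
  proof (rule Bochner_Integration.integrable_bound)
    show "integrable M (\<lambda>\<omega>. c * ?S \<omega>)"
      using square_integrable_imp_integrable[OF SM IH(2)] by simp
    have "norm (?S \<omega> * \<xi> n \<omega>) \<le> norm (c * ?S \<omega>)" if "\<omega> \<in> space M" for \<omega>
    proof -
      have "\<bar>\<xi> n \<omega>\<bar> \<le> \<bar>c\<bar>" using c[OF that] by linarith
      then show ?thesis by (simp add: abs_mult mult.commute mult_right_mono)
    qed
    then show "AE \<omega> in M. norm (?S \<omega> * \<xi> n \<omega>) \<le> norm (c * ?S \<omega>)" by (intro AE_I2)
  qed (intro borel_measurable_times SM xM)
  have Sx_meas: "(\<lambda>\<omega>. ?S \<omega> * \<xi> n \<omega>) \<in> borel_measurable (F (\<tau> n))"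
    using IH(1) st(5) by measurable
  note cross = integral_mult_increment[OF st(2,3) Sx_meas Sx]
  note diag = integral_mult_increment_square[OF st(2,3,5) x2]
  have rec: "elementary_integral B (Suc n) \<tau> \<xi> \<omega> = ?S \<omega> + \<xi> n \<omega> * ?D \<omega>" for \<omega>
    by (simp add: elementary_integral_def)
  have sq: "(elementary_integral B (Suc n) \<tau> \<xi> \<omega>)\<^sup>2
      = (?S \<omega>)\<^sup>2 + 2 * (?S \<omega> * \<xi> n \<omega> * ?D \<omega>) + (\<xi> n \<omega>)\<^sup>2 * (?D \<omega>)\<^sup>2" for \<omega>
    unfolding rec by (simp add: power2_eq_square algebra_simps)
  have "elementary_integral B (Suc n) \<tau> \<xi> \<in> borel_measurable (F (\<tau> (Suc n)))"
  proof -
    have "(\<lambda>\<omega>. ?S \<omega> + \<xi> n \<omega> * ?D \<omega>) \<in> borel_measurable (F (\<tau> (Suc n)))"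
      using measurable_F_mono[OF IH(1) st(3)] measurable_F_mono[OF st(5,3)]
        measurable_F_mono[OF adapted_B[OF st(2)] st(3)] adapted_B[of "\<tau> (Suc n)"] st(2,3)
      by (intro borel_measurable_add borel_measurable_times borel_measurable_diff) auto
    moreover have "elementary_integral B (Suc n) \<tau> \<xi> = (\<lambda>\<omega>. ?S \<omega> + \<xi> n \<omega> * ?D \<omega>)"
      by (rule ext) (rule rec)
    ultimately show ?thesis by metis
  qed
  moreover have "integrable M (\<lambda>\<omega>. (elementary_integral B (Suc n) \<tau> \<xi> \<omega>)\<^sup>2)"
    unfolding sq using IH(2) cross(1) diag(1) by auto
  moreover have "expectation (\<lambda>\<omega>. (elementary_integral B (Suc n) \<tau> \<xi> \<omega>)\<^sup>2)
      = expectation (\<lambda>\<omega>. (?S \<omega>)\<^sup>2) + expectation (\<lambda>\<omega>. (\<xi> n \<omega>)\<^sup>2) * (\<tau> (Suc n) - \<tau> n)"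
    unfolding sq using IH(2) cross diag by simp
  ultimately show ?case using IH(3) by simp
qed

text \<open>No mixed terms arise, since the intervals \<open>(\<tau> k, \<tau> (k + 1)]\<close> are pairwise disjoint.\<close>

lemma elementary_value_square:
  assumes "mono_on {..n} \<tau>"
  shows "(elementary_value n \<tau> \<xi> s \<omega>)\<^sup>2 = (\<Sum>k<n. (\<xi> k \<omega>)\<^sup>2 * indicator {\<tau> k<..\<tau> (Suc k)} s)"
  using assms
proof (induction n)
  case 0
  then show ?case by (simp add: elementary_value_def)
next
  case (Suc n)
  have IH: "(elementary_value n \<tau> \<xi> s \<omega>)\<^sup>2 = (\<Sum>k<n. (\<xi> k \<omega>)\<^sup>2 * indicator {\<tau> k<..\<tau> (Suc k)} s)"
    using Suc.IH mono_on_subset[OF Suc.prems] by force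
  have rec: "elementary_value (Suc n) \<tau> \<xi> s \<omega>
      = elementary_value n \<tau> \<xi> s \<omega> + \<xi> n \<omega> * indicator {\<tau> n<..\<tau> (Suc n)} s"
    by (simp add: elementary_value_def)
  have late: "elementary_value n \<tau> \<xi> s \<omega> = 0" if "\<tau> n < s"
    unfolding elementary_value_def
  proof (rule sum.neutral, rule ballI)
    fix k assume "k \<in> {..<n}"
    then have "\<tau> (Suc k) \<le> \<tau> n" by (intro mono_onD[OF Suc.prems]) auto
    then show "\<xi> k \<omega> * indicator {\<tau> k<..\<tau> (Suc k)} s = 0" using that by auto
  qed
  show ?case
  proof (cases "\<tau> n < s")
    case True
    have "(\<Sum>k<n. (\<xi> k \<omega>)\<^sup>2 * indicator {\<tau> k<..\<tau> (Suc k)} s) = 0"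
      by (subst IH[symmetric]) (simp add: late[OF True])
    then show ?thesis
      unfolding rec late[OF True] sum.lessThan_Suc by (simp add: indicator_def)
  next
    case False
    then show ?thesis unfolding rec sum.lessThan_Suc using IH by simp
  qed
qed

lemma elementary_isometry:
  assumes ep: "elementary_process M F T n \<tau> \<xi>"
  shows "(\<integral>\<^sup>+\<omega>. (\<integral>\<^sup>+s\<in>{0..T}. ennreal ((elementary_value n \<tau> \<xi> s \<omega>)\<^sup>2) \<partial>lborel) \<partial>M)
       = (\<integral>\<^sup>+\<omega>. ennreal ((elementary_integral B n \<tau> \<xi> \<omega>)\<^sup>2) \<partial>M)"
proof -
  have m: "mono_on {..n} \<tau>" and pos: "0 \<le> \<tau> 0" and le: "\<tau> n \<le> T"
    using ep by (auto simp: elementary_process_def)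
  have xi: "\<xi> k \<in> borel_measurable M" "\<exists>c. \<forall>\<omega>\<in>space M. \<bar>\<xi> k \<omega>\<bar> \<le> c" if "k < n" for k
    using ep that measurable_from_subalg[OF subalgebra_F] by (auto simp: elementary_process_def)
  have xi2: "integrable M (\<lambda>\<omega>. (\<xi> k \<omega>)\<^sup>2)" if "k < n" for k
    by (rule integrable_bounded_square[OF xi[OF that]])
  have step: "\<tau> k \<le> \<tau> (Suc k)" "0 \<le> \<tau> k" "\<tau> (Suc k) \<le> T" if "k < n" for k
    using mono_onD[OF m, of k "Suc k"] mono_onD[OF m, of 0 k] mono_onD[OF m, of "Suc k" n] that pos le
    by auto
  have "(\<integral>\<^sup>+s\<in>{0..T}. ennreal ((elementary_value n \<tau> \<xi> s \<omega>)\<^sup>2) \<partial>lborel)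
      = (\<Sum>k<n. ennreal ((\<xi> k \<omega>)\<^sup>2 * (\<tau> (Suc k) - \<tau> k)))" for \<omega>
  proof -
    have "(\<integral>\<^sup>+s\<in>{0..T}. ennreal ((elementary_value n \<tau> \<xi> s \<omega>)\<^sup>2) \<partial>lborel)
        = (\<integral>\<^sup>+s. (\<Sum>k<n. ennreal ((\<xi> k \<omega>)\<^sup>2) * indicator {\<tau> k<..\<tau> (Suc k)} s) \<partial>lborel)"
    proof (rule nn_integral_cong)
      fix s :: real
      have eq: "ennreal ((elementary_value n \<tau> \<xi> s \<omega>)\<^sup>2)
          = (\<Sum>k<n. ennreal ((\<xi> k \<omega>)\<^sup>2) * indicator {\<tau> k<..\<tau> (Suc k)} s)"
        unfolding elementary_value_square[OF m]
        by (subst sum_ennreal[symmetric]) (auto simp: ennreal_mult ennreal_indicator)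
      have "indicator {\<tau> k<..\<tau> (Suc k)} s * indicator {0..T} s
          = (indicator {\<tau> k<..\<tau> (Suc k)} s :: ennreal)" if "k < n" for k
        using step[OF that] by (auto simp: indicator_def)
      then have "ennreal ((\<xi> k \<omega>)\<^sup>2) * indicator {\<tau> k<..\<tau> (Suc k)} s * indicator {0..T} s
          = ennreal ((\<xi> k \<omega>)\<^sup>2) * indicator {\<tau> k<..\<tau> (Suc k)} s" if "k < n" for k
        using that by (metis mult.assoc)
      then show "ennreal ((elementary_value n \<tau> \<xi> s \<omega>)\<^sup>2) * indicator {0..T} s
          = (\<Sum>k<n. ennreal ((\<xi> k \<omega>)\<^sup>2) * indicator {\<tau> k<..\<tau> (Suc k)} s)"
        unfolding eq sum_distrib_right by (intro sum.cong refl) simp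
    qed
    also have "\<dots> = (\<Sum>k<n. ennreal ((\<xi> k \<omega>)\<^sup>2) * ennreal (\<tau> (Suc k) - \<tau> k))"
      using step by (subst nn_integral_sum) (auto intro!: sum.cong simp: nn_integral_cmult_indicator)
    also have "\<dots> = (\<Sum>k<n. ennreal ((\<xi> k \<omega>)\<^sup>2 * (\<tau> (Suc k) - \<tau> k)))"
      using step by (intro sum.cong refl ennreal_mult[symmetric]) auto
    finally show ?thesis .
  qed
  then have "(\<integral>\<^sup>+\<omega>. (\<integral>\<^sup>+s\<in>{0..T}. ennreal ((elementary_value n \<tau> \<xi> s \<omega>)\<^sup>2) \<partial>lborel) \<partial>M)
      = (\<Sum>k<n. \<integral>\<^sup>+\<omega>. ennreal ((\<xi> k \<omega>)\<^sup>2 * (\<tau> (Suc k) - \<tau> k)) \<partial>M)"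
    using xi(1) by (subst nn_integral_sum[symmetric]) (auto intro!: nn_integral_cong)
  also have "\<dots> = (\<Sum>k<n. ennreal (expectation (\<lambda>\<omega>. (\<xi> k \<omega>)\<^sup>2) * (\<tau> (Suc k) - \<tau> k)))"
    using xi2 step by (intro sum.cong refl) (subst nn_integral_eq_integral, auto)
  also have "\<dots> = ennreal (expectation (\<lambda>\<omega>. (elementary_integral B n \<tau> \<xi> \<omega>)\<^sup>2))"
    using elementary_integral_moments[OF ep] step by (subst sum_ennreal) auto
  also have "\<dots> = (\<integral>\<^sup>+\<omega>. ennreal ((elementary_integral B n \<tau> \<xi> \<omega>)\<^sup>2) \<partial>M)"
    using elementary_integral_moments[OF ep] by (subst nn_integral_eq_integral) auto
  finally show ?thesis .
qed

text \<open>One half of the isometry for general integrands, up to a constant. For elementary processes \<open>V\<close>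
  close to \<open>H\<close> the energy of \<open>V\<close> equals the second moment of its integral; the inequality
  \<open>a\<^sup>2 \<le> 2 * (a - b)\<^sup>2 + 2 * b\<^sup>2\<close>, applied once to the pair \<open>H, V\<close> and once to the integral of \<open>V\<close> and
  \<open>I\<close>, transfers this to \<open>H\<close>, with errors that vanish in the limit. The two factors 2 make up the 4.\<close>

lemma ito_integral_energy:
  assumes "has_ito_integral M F B T H I"
  shows "(\<integral>\<^sup>+\<omega>. (\<integral>\<^sup>+s\<in>{0..T}. ennreal ((H s \<omega>)\<^sup>2) \<partial>lborel) \<partial>M) \<le> 4 * (\<integral>\<^sup>+\<omega>. ennreal ((I \<omega>)\<^sup>2) \<partial>M)"
proof -
  define L where "L = restrict_space lborel {0..T}"
  interpret L: sigma_finite_measure L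
    unfolding L_def by (intro sigma_finite_measure_restrict_space lborel.sigma_finite_measure_axioms) simp
  have L: "(\<integral>\<^sup>+s\<in>{0..T}. f s \<partial>lborel) = (\<integral>\<^sup>+s. f s \<partial>L)" for f
    unfolding L_def by (subst nn_integral_restrict_space) auto
  from assms obtain n \<tau> \<xi> where
    ep: "\<And>m. elementary_process M F T (n m) (\<tau> m) (\<xi> m)" and
    lim1: "(\<lambda>m. \<integral>\<^sup>+\<omega>. (\<integral>\<^sup>+s\<in>{0..T}. ennreal ((H s \<omega> - elementary_value (n m) (\<tau> m) (\<xi> m) s \<omega>)\<^sup>2) \<partial>lborel) \<partial>M)
       \<longlonglongrightarrow> 0" (is "?e \<longlonglongrightarrow> 0") and
    lim2: "(\<lambda>m. \<integral>\<^sup>+\<omega>. ennreal ((I \<omega> - elementary_integral B (n m) (\<tau> m) (\<xi> m) \<omega>)\<^sup>2) \<partial>M) \<longlonglongrightarrow> 0"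
       (is "?i \<longlonglongrightarrow> 0")
    by (auto simp: has_ito_integral_def)
  have I[measurable]: "I \<in> borel_measurable M" using assms by (simp add: has_ito_integral_def)
  have "(\<lambda>(s, \<omega>). H s \<omega>) \<in> borel_measurable (restrict_space borel {0..T} \<Otimes>\<^sub>M M)"
    using assms by (simp add: has_ito_integral_def ito_integrand_def)
  moreover have "sets (restrict_space borel {0..T}) = sets L"
    unfolding L_def by (rule sets_restrict_space_cong) simp
  ultimately have H[measurable]: "(\<lambda>(s, \<omega>). H s \<omega>) \<in> borel_measurable (L \<Otimes>\<^sub>M M)"
    by (simp cong: measurable_cong_sets)
  have sq: "(a::real)\<^sup>2 \<le> 2 * (a - b)\<^sup>2 + 2 * b\<^sup>2" for a b
    using sum_squares_ge_zero[of "a - 2 * b" 0] by (simp add: power2_eq_square algebra_simps)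
  have sqe: "ennreal (a\<^sup>2) \<le> 2 * ennreal ((a - b)\<^sup>2) + 2 * ennreal (b\<^sup>2)" for a b :: real
    using ennreal_leI[OF sq[of a b]] by (simp add: ennreal_plus ennreal_mult)
  have bound: "(\<integral>\<^sup>+\<omega>. (\<integral>\<^sup>+s. ennreal ((H s \<omega>)\<^sup>2) \<partial>L) \<partial>M)
      \<le> 2 * ?e m + 4 * ?i m + 4 * (\<integral>\<^sup>+\<omega>. ennreal ((I \<omega>)\<^sup>2) \<partial>M)" for m
  proof -
    let ?V = "elementary_value (n m) (\<tau> m) (\<xi> m)" and ?S = "elementary_integral B (n m) (\<tau> m) (\<xi> m)"
    have xi[measurable]: "\<xi> m k \<in> borel_measurable M" if "k < n m" for k
      using ep[of m] that measurable_from_subalg[OF subalgebra_F] by (auto simp: elementary_process_def)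
    have id[measurable]: "(\<lambda>s. s) \<in> borel_measurable L"
      unfolding L_def by (rule measurable_restrict_space1) simp
    have ind: "(\<lambda>s. indicator {a<..b} s :: real) \<in> borel_measurable L" for a b
      unfolding L_def by (rule measurable_restrict_space1) simp
    have V[measurable]: "(\<lambda>(s, \<omega>). ?V s \<omega>) \<in> borel_measurable (L \<Otimes>\<^sub>M M)"
      unfolding elementary_value_def split_beta'
      by (intro borel_measurable_sum borel_measurable_times)
         (use xi ind in \<open>auto intro: measurable_compose[OF measurable_snd] measurable_compose[OF measurable_fst]\<close>)
    have S[measurable]: "?S \<in> borel_measurable M"
      using elementary_integral_moments[OF ep[of m]] measurable_from_subalg[OF subalgebra_F] by blast
    have "(\<integral>\<^sup>+\<omega>. (\<integral>\<^sup>+s. ennreal ((H s \<omega>)\<^sup>2) \<partial>L) \<partial>M)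
        \<le> (\<integral>\<^sup>+\<omega>. (\<integral>\<^sup>+s. 2 * ennreal ((H s \<omega> - ?V s \<omega>)\<^sup>2) + 2 * ennreal ((?V s \<omega>)\<^sup>2) \<partial>L) \<partial>M)"
      by (intro nn_integral_mono sqe)
    also have "\<dots> = 2 * ?e m + 2 * (\<integral>\<^sup>+\<omega>. (\<integral>\<^sup>+s. ennreal ((?V s \<omega>)\<^sup>2) \<partial>L) \<partial>M)"
    proof -
      have "(\<integral>\<^sup>+s. 2 * ennreal ((H s \<omega> - ?V s \<omega>)\<^sup>2) + 2 * ennreal ((?V s \<omega>)\<^sup>2) \<partial>L)
          = 2 * (\<integral>\<^sup>+s. ennreal ((H s \<omega> - ?V s \<omega>)\<^sup>2) \<partial>L) + 2 * (\<integral>\<^sup>+s. ennreal ((?V s \<omega>)\<^sup>2) \<partial>L)"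
        if [measurable]: "\<omega> \<in> space M" for \<omega>
        by (subst nn_integral_add) (simp_all add: nn_integral_cmult)
      then show ?thesis
        unfolding L by (simp add: nn_integral_add nn_integral_cmult cong: nn_integral_cong)
    qed
    also have "(\<integral>\<^sup>+\<omega>. (\<integral>\<^sup>+s. ennreal ((?V s \<omega>)\<^sup>2) \<partial>L) \<partial>M) = (\<integral>\<^sup>+\<omega>. ennreal ((?S \<omega>)\<^sup>2) \<partial>M)"
      using elementary_isometry[OF ep[of m]] unfolding L .
    also have "\<dots> \<le> (\<integral>\<^sup>+\<omega>. 2 * ennreal ((I \<omega> - ?S \<omega>)\<^sup>2) + 2 * ennreal ((I \<omega>)\<^sup>2) \<partial>M)"
      using sqe[of "?S _" "I _"] by (intro nn_integral_mono) (simp add: power2_commute)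
    also have "\<dots> = 2 * ?i m + 2 * (\<integral>\<^sup>+\<omega>. ennreal ((I \<omega>)\<^sup>2) \<partial>M)"
      by (simp add: nn_integral_add nn_integral_cmult)
    finally show ?thesis
      by (simp add: distrib_left mult.assoc[symmetric] add.assoc mult_left_mono add_left_mono)
  qed
  have "(\<lambda>m. 2 * ?e m + 4 * ?i m + 4 * (\<integral>\<^sup>+\<omega>. ennreal ((I \<omega>)\<^sup>2) \<partial>M))
      \<longlonglongrightarrow> 2 * 0 + 4 * 0 + 4 * (\<integral>\<^sup>+\<omega>. ennreal ((I \<omega>)\<^sup>2) \<partial>M)"
    by (intro tendsto_add tendsto_const ennreal_tendsto_cmult lim1 lim2) simp_all
  from LIMSEQ_le_const[OF this] bound show ?thesis unfolding L by simp
qed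

lemma ito_solution_integrand_measurable:
  assumes "ito_solution M F B \<sigma> x X" "0 \<le> T"
  shows "(\<lambda>(s, \<omega>). \<sigma> (X s \<omega>)) \<in> borel_measurable (restrict_space lborel {0..T} \<Otimes>\<^sub>M M)"
proof -
  have "(\<lambda>(s, \<omega>). \<sigma> (X s \<omega>)) \<in> borel_measurable (restrict_space borel {0..T} \<Otimes>\<^sub>M M)"
    using assms by (auto simp: ito_solution_def has_ito_integral_def ito_integrand_def)
  moreover have "sets (restrict_space borel {0..T}) = sets (restrict_space lborel {0..T})"
    by (rule sets_restrict_space_cong) simp
  ultimately show ?thesis by (simp cong: measurable_cong_sets)
qed

text \<open>A solution confined to \<open>[0, 1]\<close> has a stochastic integral \<open>X T - x\<close> of modulus at most 1, so the
  energy of \<open>\<sigma> (X)\<close> over \<open>[0, T]\<close> is bounded independently of \<open>T\<close>. This is what forces the solution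
  towards the zeros of \<open>\<sigma>\<close>.\<close>

lemma ito_solution_energy:
  assumes sol: "ito_solution M F B \<sigma> x X" and x: "x \<in> {0..1}" and "0 \<le> T"
    and X01: "\<And>\<omega>. \<omega> \<in> space M \<Longrightarrow> X T \<omega> \<in> {0..1}"
  shows "(\<integral>\<^sup>+s\<in>{0..T}. (\<integral>\<^sup>+\<omega>. ennreal ((\<sigma> (X s \<omega>))\<^sup>2) \<partial>M) \<partial>lborel) \<le> 4"
proof -
  define L where "L = restrict_space lborel {0..T}"
  interpret L: sigma_finite_measure L
    unfolding L_def by (intro sigma_finite_measure_restrict_space lborel.sigma_finite_measure_axioms) simp
  interpret LM: pair_sigma_finite L M ..
  have L: "(\<integral>\<^sup>+s\<in>{0..T}. f s \<partial>lborel) = (\<integral>\<^sup>+s. f s \<partial>L)" for f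
    unfolding L_def by (subst nn_integral_restrict_space) auto
  obtain I where I: "has_ito_integral M F B T (\<lambda>s \<omega>. \<sigma> (X s \<omega>)) I" "AE \<omega> in M. X T \<omega> = x + I \<omega>"
    using sol \<open>0 \<le> T\<close> by (auto simp: ito_solution_def)
  have [measurable]: "(\<lambda>(s, \<omega>). \<sigma> (X s \<omega>)) \<in> borel_measurable (L \<Otimes>\<^sub>M M)"
    unfolding L_def by (rule ito_solution_integrand_measurable[OF sol \<open>0 \<le> T\<close>])
  have "(\<integral>\<^sup>+s. (\<integral>\<^sup>+\<omega>. ennreal ((\<sigma> (X s \<omega>))\<^sup>2) \<partial>M) \<partial>L) = (\<integral>\<^sup>+\<omega>. (\<integral>\<^sup>+s. ennreal ((\<sigma> (X s \<omega>))\<^sup>2) \<partial>L) \<partial>M)"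
    by (rule LM.Fubini'[symmetric]) measurable
  also have "\<dots> \<le> 4 * (\<integral>\<^sup>+\<omega>. ennreal ((I \<omega>)\<^sup>2) \<partial>M)"
    using ito_integral_energy[OF I(1)] unfolding L .
  also have "(\<integral>\<^sup>+\<omega>. ennreal ((I \<omega>)\<^sup>2) \<partial>M) \<le> (\<integral>\<^sup>+\<omega>. 1 \<partial>M)"
  proof (rule nn_integral_mono_AE)
    show "AE \<omega> in M. ennreal ((I \<omega>)\<^sup>2) \<le> 1"
      using I(2) AE_space
    proof eventually_elim
      case (elim \<omega>)
      have "\<bar>I \<omega>\<bar> \<le> 1" using elim x X01[OF elim(2)] by auto
      then have "(I \<omega>)\<^sup>2 \<le> 1" by (simp add: abs_square_le_1)
      then show ?case by (metis ennreal_1 ennreal_leI)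
    qed
  qed
  finally show ?thesis unfolding L by (simp add: emeasure_space_1 mult_left_mono)
qed

end

section \<open>Brownian motion on the Wiener space\<close>

lemma borel_measurable_vec_lambda:
  fixes f :: "'a \<Rightarrow> 'n::finite \<Rightarrow> real"
  assumes "\<And>i. (\<lambda>x. f x i) \<in> borel_measurable N"
  shows "(\<lambda>x. \<chi> i. f x i) \<in> borel_measurable N"
  using assms by (subst borel_measurable_euclidean_space) (auto simp: Basis_vec_def inner_axis)

lemma borel_measurable_vec_nth [measurable]: "(\<lambda>x::real ^ 'n. x $ i) \<in> borel_measurable borel"
  by (intro borel_measurable_continuous_onI continuous_intros)

context
  fixes M :: "(real \<Rightarrow> real ^ 'n) measure"
  assumes W: "two_sided_wiener_space M"
begin

lemma prob_space_wiener: "prob_space M"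
  using W by (simp add: two_sided_wiener_space_def)

lemma sets_wiener: "sets M = sets (restrict_space (\<Pi>\<^sub>M t\<in>UNIV. borel) wiener_paths)"
  using W by (simp add: two_sided_wiener_space_def)

lemma space_wiener: "space M = wiener_paths"
  using sets_eq_imp_space_eq[OF sets_wiener] by (simp add: space_restrict_space space_PiM)

lemma measurable_wiener_evaluation [measurable]: "(\<lambda>\<omega>. \<omega> t) \<in> borel_measurable M"
proof -
  have "(\<lambda>\<omega>. \<omega> t) \<in> borel_measurable (restrict_space (\<Pi>\<^sub>M t\<in>UNIV. borel) wiener_paths)"
    by (rule measurable_restrict_space1) simp
  then show ?thesis using measurable_cong_sets[OF sets_wiener refl] by blast
qed

lemma wiener_path_0: "\<omega> \<in> space M \<Longrightarrow> \<omega> 0 = 0"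
  by (simp add: space_wiener wiener_paths_def)

text \<open>The finitely many times in \<open>J\<close>, together with \<open>0\<close>, \<open>s\<close> and \<open>t\<close>, are arranged in increasing order.
  As paths start in \<open>0\<close>, the values at times up to \<open>s\<close> are sums of the increments before the last one,
  and the last one is the increment from \<open>s\<close> to \<open>t\<close>; so independence of consecutive increments
  applies.\<close>

lemma cylinder_indep_increment:
  assumes J: "finite J" "J \<subseteq> {0..s}" and st: "0 \<le> s" "s < t"
    and Br: "\<And>r. r \<in> J \<Longrightarrow> Br r \<in> sets borel" and A: "A \<in> sets borel"
  shows "measure M ({\<omega>\<in>space M. \<forall>r\<in>J. \<omega> r \<in> Br r} \<inter> ((\<lambda>\<omega>. \<omega> t $ i - \<omega> s $ i) -` A \<inter> space M))
    = measure M {\<omega>\<in>space M. \<forall>r\<in>J. \<omega> r \<in> Br r} *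
      measure M ((\<lambda>\<omega>. \<omega> t $ i - \<omega> s $ i) -` A \<inter> space M)"
proof -
  interpret prob_space M by (rule prob_space_wiener)
  define xs where "xs = sorted_list_of_set (insert 0 (insert s J))"
  define n where "n = length xs - 1"
  define \<tau> where "\<tau> = (\<lambda>k. if k \<le> n then xs ! k else t)"
  have xs: "set xs = insert 0 (insert s J)" "sorted_wrt (<) xs"
    unfolding xs_def using J(1) by (simp_all only: set_sorted_list_of_set strict_sorted_list_of_set finite_insert)
  have len: "length xs = Suc n" using xs(1) by (cases xs) (auto simp: n_def)
  have ind_ex: "\<exists>k\<le>n. \<tau> k = r" if "r \<in> insert 0 (insert s J)" for r
    using that xs(1) len unfolding \<tau>_def by (metis in_set_conv_nth less_Suc_eq_le)
  have range: "0 \<le> \<tau> k" "\<tau> k \<le> s" if "k \<le> n" for k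
  proof -
    have "xs ! k \<in> set xs" using that len by simp
    then show "0 \<le> \<tau> k" "\<tau> k \<le> s" using that xs(1) J st by (auto simp: \<tau>_def)
  qed
  have mono: "\<tau> k < \<tau> l" if "k < l" "l \<le> n" for k l
    using sorted_wrt_nth_less[OF xs(2), of k l] that len by (auto simp: \<tau>_def)
  have last: "\<tau> (Suc n) = t" by (simp add: \<tau>_def)
  have tau_n: "\<tau> n = s"
  proof -
    obtain k where "k \<le> n" "\<tau> k = s" using ind_ex[of s] by auto
    then show ?thesis using mono[of k n] range(2)[of n] by (cases "k = n") auto
  qed
  have tau_0: "\<tau> 0 = 0"
  proof -
    obtain k where "k \<le> n" "\<tau> k = 0" using ind_ex[of 0] by auto
    then show ?thesis using mono[of 0 k] range(1)[of 0] by (cases "k = 0") auto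
  qed
  have "strict_mono_on {..Suc n} \<tau>"
  proof (rule strict_mono_onI)
    fix k l assume "k \<in> {..Suc n}" "l \<in> {..Suc n}" "k < l"
    then show "\<tau> k < \<tau> l"
      using mono[of k l] range(2)[of k] st last by (cases "l = Suc n") auto
  qed
  then have ind: "indep_vars (\<lambda>_. borel) (\<lambda>(k, i) \<omega>. (\<omega> (\<tau> (Suc k)) - \<omega> (\<tau> k)) $ i) ({..<Suc n} \<times> UNIV)"
    using W unfolding two_sided_wiener_space_def by blast
  define X :: "nat \<times> 'n \<Rightarrow> (real \<Rightarrow> real ^ 'n) \<Rightarrow> real"
    where "X = (\<lambda>(k, i) \<omega>. (\<omega> (\<tau> (Suc k)) - \<omega> (\<tau> k)) $ i)"
  let ?K = "{..<n} \<times> (UNIV :: 'n set)" and ?L = "{(n, i)}"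
  have iv: "indep_var (PiM ?K (\<lambda>_. borel)) (\<lambda>\<omega>. restrict (\<lambda>j. X j \<omega>) ?K)
                      (PiM ?L (\<lambda>_. borel)) (\<lambda>\<omega>. restrict (\<lambda>j. X j \<omega>) ?L)"
    by (rule indep_var_restrict[OF ind[folded X_def]]) auto
  \<comment> \<open>\<open>g k\<close> rebuilds the path at time \<open>\<tau> k\<close> from the increments.\<close>
  define g :: "nat \<Rightarrow> (nat \<times> 'n \<Rightarrow> real) \<Rightarrow> real ^ 'n" where "g = (\<lambda>k v. \<chi> i. \<Sum>l<k. v (l, i))"
  have "\<forall>r\<in>J. \<exists>k. k \<le> n \<and> \<tau> k = r" using ind_ex by blast
  then obtain \<kappa> where \<kappa>: "\<And>r. r \<in> J \<Longrightarrow> \<kappa> r \<le> n \<and> \<tau> (\<kappa> r) = r" by (auto dest!: bchoice)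
  have g: "g k \<in> borel_measurable (PiM ?K (\<lambda>_. borel))" if "k \<le> n" for k
    unfolding g_def using that
    by (intro borel_measurable_vec_lambda borel_measurable_sum measurable_component_singleton) auto
  have gX: "g k (restrict (\<lambda>j. X j \<omega>) ?K) = \<omega> (\<tau> k)" if "k \<le> n" "\<omega> \<in> space M" for k \<omega>
  proof -
    have "(\<Sum>l<k. restrict (\<lambda>j. X j \<omega>) ?K (l, i)) = \<omega> (\<tau> k) $ i" for i
    proof -
      have "(\<Sum>l<k. restrict (\<lambda>j. X j \<omega>) ?K (l, i)) = (\<Sum>l<k. \<omega> (\<tau> (Suc l)) $ i - \<omega> (\<tau> l) $ i)"
        using that by (intro sum.cong) (auto simp: X_def)
      also have "\<dots> = \<omega> (\<tau> k) $ i - \<omega> (\<tau> 0) $ i" by (rule sum_lessThan_telescope)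
      finally show ?thesis using wiener_path_0[OF that(2)] tau_0 by simp
    qed
    then show ?thesis by (simp add: g_def vec_eq_iff)
  qed
  define S where "S = {v \<in> space (PiM ?K (\<lambda>_. borel)). \<forall>r\<in>J. g (\<kappa> r) v \<in> Br r}"
  define S' where "S' = {v \<in> space (PiM ?L (\<lambda>_. borel)). v (n, i) \<in> A}"
  have S: "S \<in> sets (PiM ?K (\<lambda>_. borel))"
    unfolding S_def using J(1) \<kappa> Br
    by (intro sets.sets_Collect_finite_All measurable_sets_Collect[OF g]) auto
  have S': "S' \<in> sets (PiM ?L (\<lambda>_. borel))"
    unfolding S'_def using A
    by (intro measurable_sets_Collect[OF measurable_component_singleton[of "(n, i)"]]) auto
  have eq: "(\<lambda>\<omega>. restrict (\<lambda>j. X j \<omega>) ?K) -` S \<inter> space M = {\<omega>\<in>space M. \<forall>r\<in>J. \<omega> r \<in> Br r}"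
    using gX \<kappa> by (auto simp: S_def space_PiM)
  have eq': "(\<lambda>\<omega>. restrict (\<lambda>j. X j \<omega>) ?L) -` S' \<inter> space M = (\<lambda>\<omega>. \<omega> t $ i - \<omega> s $ i) -` A \<inter> space M"
    using last tau_n by (auto simp: S'_def space_PiM X_def)
  have "(\<lambda>\<omega>. (restrict (\<lambda>j. X j \<omega>) ?K, restrict (\<lambda>j. X j \<omega>) ?L)) -` (S \<times> S') \<inter> space M
      = ((\<lambda>\<omega>. restrict (\<lambda>j. X j \<omega>) ?K) -` S \<inter> space M) \<inter> ((\<lambda>\<omega>. restrict (\<lambda>j. X j \<omega>) ?L) -` S' \<inter> space M)"
    by auto
  then show ?thesis
    using indep_varD[OF iv S S'] unfolding eq eq' by simp
qed

lemma wiener_filtration_gens: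
  "{(\<lambda>\<omega>. \<omega> s) -` A \<inter> space M | s A. 0 \<le> s \<and> s \<le> t \<and> A \<in> sets borel} \<union> null_sets M \<subseteq> sets M"
proof (rule Un_least)
  show "{(\<lambda>\<omega>. \<omega> s) -` A \<inter> space M | s A. 0 \<le> s \<and> s \<le> t \<and> A \<in> sets borel} \<subseteq> sets M"
    by (clarify, rule measurable_sets[OF measurable_wiener_evaluation])
  show "null_sets M \<subseteq> sets M" by (blast intro: null_setsD2)
qed

lemma sets_wiener_filtration: "sets (wiener_filtration M t) = sigma_sets (space M)
   ({(\<lambda>\<omega>. \<omega> s) -` A \<inter> space M | s A. 0 \<le> s \<and> s \<le> t \<and> A \<in> sets borel} \<union> null_sets M)"
  unfolding wiener_filtration_def
  by (rule sets_measure_of[OF order_trans[OF wiener_filtration_gens sets.space_closed]])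

lemma space_wiener_filtration: "space (wiener_filtration M t) = space M"
  unfolding wiener_filtration_def
  by (rule space_measure_of[OF order_trans[OF wiener_filtration_gens sets.space_closed]])

lemma subalgebra_wiener_filtration: "subalgebra M (wiener_filtration M t)"
  unfolding subalgebra_def space_wiener_filtration sets_wiener_filtration
  using sets.sigma_sets_subset[OF wiener_filtration_gens] by simp

text \<open>The cylinder events of the past generate its \<open>\<sigma>\<close>-algebra up to null sets. Together with the null
  sets they still form an intersection-stable family, and null sets are independent of everything, so
  independence passes from the cylinders to the augmented \<open>\<sigma>\<close>-algebra.\<close>

lemma wiener_filtration_indep_increment:
  assumes st: "0 \<le> s" "s < t"
  shows "prob_space.indep_set M (sets (wiener_filtration M s))
    {(\<lambda>\<omega>. \<omega> t $ i - \<omega> s $ i) -` A \<inter> space M | A. A \<in> sets borel}"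
proof -
  interpret prob_space M by (rule prob_space_wiener)
  define C where "C = {{\<omega>\<in>space M. \<forall>r\<in>J. \<omega> r \<in> Br r} | J Br :: real \<Rightarrow> (real ^ 'n) set.
    finite J \<and> J \<subseteq> {0..s} \<and> (\<forall>r\<in>J. Br r \<in> sets borel)}"
  define D where "D = {(\<lambda>\<omega>. \<omega> t $ i - \<omega> s $ i) -` A \<inter> space M | A. A \<in> sets borel}"
  have Cev: "C \<subseteq> events"
  proof
    fix a assume "a \<in> C"
    then obtain J Br where a: "a = {\<omega>\<in>space M. \<forall>r\<in>J. \<omega> r \<in> Br r}" "finite J" "\<forall>r\<in>J. Br r \<in> sets borel"
      unfolding C_def by blast
    show "a \<in> events"
      unfolding a(1) using a(2,3)
      by (intro sets.sets_Collect_finite_All measurable_sets_Collect[OF measurable_wiener_evaluation]) auto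
  qed
  have incr: "(\<lambda>\<omega>. \<omega> t $ i - \<omega> s $ i) \<in> borel_measurable M"
    by (intro borel_measurable_diff measurable_compose[OF measurable_wiener_evaluation borel_measurable_vec_nth])
  have Dev: "D \<subseteq> events"
    unfolding D_def using measurable_sets[OF incr] by auto
  have "indep_set (C \<union> null_sets M) D"
  proof (rule indep_setI)
    fix a b assume a: "a \<in> C \<union> null_sets M" and b: "b \<in> D"
    show "prob (a \<inter> b) = prob a * prob b"
    proof (cases "a \<in> null_sets M")
      case True
      then have "a \<inter> b \<in> null_sets M" using b Dev by (intro null_set_Int2) auto
      then show ?thesis using True by (simp add: measure_eq_0_null_sets)
    next
      case False
      with a obtain J Br where J: "a = {\<omega>\<in>space M. \<forall>r\<in>J. \<omega> r \<in> Br r}" "finite J" "J \<subseteq> {0..s}"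
        "\<And>r. r \<in> J \<Longrightarrow> Br r \<in> sets borel" unfolding C_def by blast
      obtain A where A: "b = (\<lambda>\<omega>. \<omega> t $ i - \<omega> s $ i) -` A \<inter> space M" "A \<in> sets borel"
        using b unfolding D_def by blast
      show ?thesis
        unfolding J(1) A(1) by (rule cylinder_indep_increment[OF J(2,3) st J(4) A(2)])
    qed
  next
    show "C \<union> null_sets M \<subseteq> events" using Cev by (auto intro: null_setsD2)
  qed (rule Dev)
  moreover have "Int_stable (C \<union> null_sets M)"
  proof (rule Int_stableI)
    fix a b assume ab: "a \<in> C \<union> null_sets M" "b \<in> C \<union> null_sets M"
    show "a \<inter> b \<in> C \<union> null_sets M"
    proof (cases "a \<in> null_sets M \<or> b \<in> null_sets M")
      case True
      moreover have "a \<in> sets M" "b \<in> sets M" using ab Cev by (auto intro: null_setsD2)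
      ultimately have "a \<inter> b \<in> null_sets M" by (metis null_set_Int1 null_set_Int2)
      then show ?thesis by blast
    next
      case False
      then obtain J Br J' Br' where
        a: "a = {\<omega>\<in>space M. \<forall>r\<in>J. \<omega> r \<in> Br r}" "finite J" "J \<subseteq> {0..s}" "\<forall>r\<in>J. Br r \<in> sets borel" and
        b: "b = {\<omega>\<in>space M. \<forall>r\<in>J'. \<omega> r \<in> Br' r}" "finite J'" "J' \<subseteq> {0..s}" "\<forall>r\<in>J'. Br' r \<in> sets borel"
        using ab unfolding C_def by blast
      let ?B = "\<lambda>r. (if r \<in> J then Br r else UNIV) \<inter> (if r \<in> J' then Br' r else UNIV)"
      have "a \<inter> b = {\<omega>\<in>space M. \<forall>r\<in>J \<union> J'. \<omega> r \<in> ?B r}" unfolding a(1) b(1) by auto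
      moreover have "finite (J \<union> J')" "J \<union> J' \<subseteq> {0..s}" "\<forall>r\<in>J \<union> J'. ?B r \<in> sets borel"
        using a b by auto
      ultimately have "a \<inter> b \<in> C"
        unfolding C_def by (intro CollectI exI[of _ "J \<union> J'"] exI[of _ ?B] conjI)
      then show ?thesis ..
    qed
  qed
  moreover have "Int_stable D"
    unfolding D_def by (rule Int_stable_vimage_sets)
  ultimately have ind: "indep_set (sigma_sets (space M) (C \<union> null_sets M)) (sigma_sets (space M) D)"
    by (rule indep_set_sigma_sets)
  have "sets (wiener_filtration M s) \<subseteq> sigma_sets (space M) (C \<union> null_sets M)"
    unfolding sets_wiener_filtration
  proof (rule sigma_sets_mono', rule Un_mono)
    show "{(\<lambda>\<omega>. \<omega> r) -` A \<inter> space M | r A. 0 \<le> r \<and> r \<le> s \<and> A \<in> sets borel} \<subseteq> C"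
    proof safe
      fix r and A :: "(real ^ 'n) set" assume "0 \<le> r" "r \<le> s" "A \<in> sets borel"
      then show "(\<lambda>\<omega>. \<omega> r) -` A \<inter> space M \<in> C"
        unfolding C_def by (intro CollectI exI[of _ "{r}"] exI[of _ "\<lambda>_. A"]) auto
    qed
  qed simp
  then show ?thesis
    unfolding D_def[symmetric]
    using indep_setD[OF ind] indep_setD_ev1[OF ind] indep_setD_ev2[OF ind]
    by (intro indep_setI) (blast, blast, blast)
qed

lemma filtered_brownian_motion_wiener:
  "filtered_brownian_motion M (wiener_filtration M) (\<lambda>t \<omega>. \<omega> t $ i)"
proof (intro filtered_brownian_motion.intro filtered_brownian_motion_axioms.intro prob_space_wiener
    subalgebra_wiener_filtration wiener_filtration_indep_increment)
  show "sets (wiener_filtration M s) \<subseteq> sets (wiener_filtration M t)" if "s \<le> t" for s t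
    unfolding sets_wiener_filtration using that by (intro sigma_sets_mono' Un_mono order_refl Collect_mono) (blast intro: order_trans)
  show "(\<lambda>\<omega>. \<omega> t $ i) \<in> borel_measurable (wiener_filtration M t)" if "0 \<le> t" for t
  proof (rule measurable_compose[OF _ borel_measurable_vec_nth], rule measurableI)
    fix A :: "(real ^ 'n) set" assume "A \<in> sets borel"
    then show "(\<lambda>\<omega>. \<omega> t) -` A \<inter> space (wiener_filtration M t) \<in> sets (wiener_filtration M t)"
      using that unfolding sets_wiener_filtration space_wiener_filtration by (intro sigma_sets.Basic) auto
  qed simp
  show "distributed M lborel (\<lambda>\<omega>. \<omega> t $ i - \<omega> s $ i) (\<lambda>x. ennreal (normal_density 0 (sqrt (t - s)) x))"
    if "s < t" for s t
    using W that by (simp add: two_sided_wiener_space_def)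
qed

end

section \<open>Trajectories approach the end points\<close>

lemma bounded_integrals_small_time:
  fixes f :: "'j \<Rightarrow> real \<Rightarrow> ennreal" and K \<epsilon> :: real
  assumes J: "finite J"
    and meas: "\<And>j T. j \<in> J \<Longrightarrow> 0 \<le> T \<Longrightarrow> f j \<in> borel_measurable (restrict_space lborel {0..T})"
    and bound: "\<And>j T. j \<in> J \<Longrightarrow> 0 \<le> T \<Longrightarrow> (\<integral>\<^sup>+s\<in>{0..T}. f j s \<partial>lborel) \<le> ennreal K"
    and K: "0 \<le> K" and \<epsilon>: "0 < \<epsilon>"
  shows "\<exists>t\<ge>T0. 0 \<le> t \<and> (\<forall>j\<in>J. f j t < ennreal \<epsilon>)"
proof (rule ccontr)
  assume "\<not> ?thesis"
  then have no: "\<exists>j\<in>J. ennreal \<epsilon> \<le> f j t" if "T0 \<le> t" "0 \<le> t" for t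
    using that by (auto simp: not_less)
  define T1 where "T1 = max 0 T0"
  \<comment> \<open>If some \<open>f j\<close> were at least \<open>\<epsilon>\<close> at every time after \<open>T1\<close>, the integrals up to \<open>T\<close> would add up to at least \<open>K * card J + 1\<close>.\<close>
  define T where "T = T1 + (K * card J + 1) / \<epsilon>"
  have T: "0 \<le> T1" "T1 \<le> T" "0 \<le> T" using K \<epsilon> by (auto simp: T1_def T_def)
  have restr: "(\<integral>\<^sup>+s\<in>{0..T}. g s \<partial>lborel) = (\<integral>\<^sup>+s. g s \<partial>restrict_space lborel {0..T})" for g
    by (subst nn_integral_restrict_space) auto
  have low: "ennreal \<epsilon> * indicator {T1..T} s \<le> (\<Sum>j\<in>J. f j s) * indicator {0..T} s" for s
  proof (cases "s \<in> {T1..T}")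
    case True
    then obtain j where j: "j \<in> J" "ennreal \<epsilon> \<le> f j s" using no[of s] by (auto simp: T1_def)
    have "f j s \<le> (\<Sum>j\<in>J. f j s)" using J j(1) by (intro member_le_sum) auto
    then show ?thesis using True T j(2) by (auto simp: indicator_def)
  qed simp
  have "ennreal (K * card J + 1) = (\<integral>\<^sup>+s. ennreal \<epsilon> * indicator {T1..T} s \<partial>lborel)"
    using T K \<epsilon> by (subst nn_integral_cmult_indicator) (auto simp: T_def ennreal_mult[symmetric])
  also have "\<dots> \<le> (\<integral>\<^sup>+s\<in>{0..T}. (\<Sum>j\<in>J. f j s) \<partial>lborel)"
    by (intro nn_integral_mono low)
  also have "\<dots> = (\<Sum>j\<in>J. (\<integral>\<^sup>+s\<in>{0..T}. f j s \<partial>lborel))"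
    unfolding restr by (rule nn_integral_sum) (rule meas[OF _ T(3)])
  also have "\<dots> \<le> (\<Sum>j\<in>J. ennreal K)"
    by (intro sum_mono bound T(3))
  also have "\<dots> = ennreal (K * card J)"
    using K by (simp add: ennreal_mult ennreal_of_nat_eq_real_of_nat mult.commute)
  finally show False using K by (simp add: ennreal_le_iff)
qed

lemma solution_flow_component_measurable:
  fixes M :: "(real \<Rightarrow> real ^ 'n) measure"
  assumes "two_sided_wiener_space M" "solution_flow M \<phi>" "x \<in> unit_cube" "0 \<le> t"
  shows "(\<lambda>\<omega>. \<phi> t \<omega> x $ i) \<in> borel_measurable M"
proof -
  have "(\<lambda>\<omega>. \<phi> t \<omega> x $ i) \<in> borel_measurable (wiener_filtration M t)"
    using assms(2-4) by (simp add: solution_flow_def ito_solution_def)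
  then show ?thesis by (rule measurable_from_subalg[OF subalgebra_wiener_filtration[OF assms(1)]])
qed

text \<open>Along a trajectory \<open>u\<close> of a coordinate, \<open>E[(u * (1 - u))\<^sup>2]\<close> has a finite integral over all times, so it
  is small at arbitrarily late times, for finitely many initial points and all coordinates at once. By
  Markov's inequality and \<open>u * (1 - u) \<ge> \<epsilon>\<^sup>2\<close> on \<open>(\<epsilon>, 1 - \<epsilon>)\<close>, the trajectory is then likely to be within
  \<open>\<epsilon>\<close> of \<open>0\<close> or \<open>1\<close>.\<close>

lemma flow_leaves_interior:
  fixes M :: "(real \<Rightarrow> real ^ 'n) measure"
  assumes W: "two_sided_wiener_space M" and sol: "solution_flow M \<phi>"
    and cube: "\<And>t \<omega> x. \<omega> \<in> space M \<Longrightarrow> x \<in> unit_cube \<Longrightarrow> \<phi> t \<omega> x \<in> unit_cube"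
    and P: "finite P" "P \<subseteq> unit_cube" and \<epsilon>: "0 < \<epsilon>" and \<eta>: "0 < \<eta>"
  shows "\<exists>t\<ge>T0. 0 \<le> t \<and> (\<forall>x\<in>P. \<forall>i.
    measure M {\<omega>\<in>space M. \<epsilon> < \<phi> t \<omega> x $ i \<and> \<phi> t \<omega> x $ i < 1 - \<epsilon>} < \<eta>)"
proof -
  interpret prob_space M using prob_space_wiener[OF W] .
  let ?\<sigma> = "\<lambda>u::real. u * (1 - u)"
  let ?f = "\<lambda>(x, i) s. \<integral>\<^sup>+\<omega>. ennreal ((?\<sigma> (\<phi> s \<omega> x $ i))\<^sup>2) \<partial>M"
  have solx: "ito_solution M (wiener_filtration M) (\<lambda>t \<omega>. \<omega> t $ i) ?\<sigma> (x $ i) (\<lambda>t \<omega>. \<phi> t \<omega> x $ i)"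
    if "x \<in> unit_cube" for x i
    using sol that by (auto simp: solution_flow_def)
  have "\<exists>t\<ge>T0. 0 \<le> t \<and> (\<forall>j\<in>P \<times> UNIV. ?f j t < ennreal (\<epsilon> ^ 4 * \<eta>))"
  proof (rule bounded_integrals_small_time)
    fix j T assume j: "j \<in> P \<times> (UNIV :: 'n set)" and T: "(0::real) \<le> T"
    obtain x i where ji: "j = (x, i)" and x: "x \<in> unit_cube" using j P(2) by auto
    interpret B: filtered_brownian_motion M "wiener_filtration M" "\<lambda>t \<omega>. \<omega> t $ i"
      by (rule filtered_brownian_motion_wiener[OF W])
    have [measurable]: "(\<lambda>(s, \<omega>). ?\<sigma> (\<phi> s \<omega> x $ i)) \<in> borel_measurable (restrict_space lborel {0..T} \<Otimes>\<^sub>M M)"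
      by (rule B.ito_solution_integrand_measurable[OF solx[OF x] T])
    show "?f j \<in> borel_measurable (restrict_space lborel {0..T})"
      unfolding ji prod.case by measurable
    have "(\<integral>\<^sup>+s\<in>{0..T}. ?f (x, i) s \<partial>lborel) \<le> 4"
      unfolding prod.case
      by (rule B.ito_solution_energy[OF solx[OF x] _ T]) (use x cube in \<open>auto simp: unit_cube_def\<close>)
    then show "(\<integral>\<^sup>+s\<in>{0..T}. ?f j s \<partial>lborel) \<le> ennreal 4" unfolding ji by simp
  qed (use P \<epsilon> \<eta> in auto)
  then obtain t where t: "t \<ge> T0" "0 \<le> t" and small: "\<And>x i. x \<in> P \<Longrightarrow> ?f (x, i) t < ennreal (\<epsilon> ^ 4 * \<eta>)"
    by auto
  have "measure M {\<omega>\<in>space M. \<epsilon> < \<phi> t \<omega> x $ i \<and> \<phi> t \<omega> x $ i < 1 - \<epsilon>} < \<eta>" (is "measure M ?S < _")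
    if x: "x \<in> P" for x i
  proof -
    have X: "(\<lambda>\<omega>. \<phi> t \<omega> x $ i) \<in> borel_measurable M"
      using x P(2) by (intro solution_flow_component_measurable[OF W sol _ t(2)]) blast
    then have S: "?S \<in> sets M" by measurable
    have le: "ennreal (\<epsilon> ^ 4) * indicator ?S \<omega> \<le> ennreal ((?\<sigma> (\<phi> t \<omega> x $ i))\<^sup>2)" for \<omega>
    proof (cases "\<omega> \<in> ?S")
      case True
      then have "\<epsilon> * \<epsilon> \<le> ?\<sigma> (\<phi> t \<omega> x $ i)" using \<epsilon> by (intro mult_mono) auto
      then have "(\<epsilon> * \<epsilon>)\<^sup>2 \<le> (?\<sigma> (\<phi> t \<omega> x $ i))\<^sup>2" using \<epsilon> by (intro power_mono) auto
      moreover have "(\<epsilon> * \<epsilon>)\<^sup>2 = \<epsilon> ^ 4" by (simp add: power2_eq_square power4_eq_xxxx mult.assoc)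
      ultimately show ?thesis using True by (auto intro!: ennreal_leI)
    qed simp
    have "ennreal (\<epsilon> ^ 4 * prob ?S) = (\<integral>\<^sup>+\<omega>. ennreal (\<epsilon> ^ 4) * indicator ?S \<omega> \<partial>M)"
      using S \<epsilon> by (simp add: nn_integral_cmult_indicator emeasure_eq_measure ennreal_mult)
    also have "\<dots> \<le> ?f (x, i) t" unfolding prod.case by (intro nn_integral_mono le)
    also have "\<dots> < ennreal (\<epsilon> ^ 4 * \<eta>)" by (rule small[OF x])
    finally have "\<epsilon> ^ 4 * prob ?S < \<epsilon> ^ 4 * \<eta>" using \<epsilon> by (subst (asm) ennreal_less_iff) auto
    then show ?thesis using \<epsilon> by simp
  qed
  then show ?thesis using t by blast
qed

section \<open>Distances in the cube and attraction\<close>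

lemma sup_dist_le_iff: "sup_dist x y \<le> r \<longleftrightarrow> (\<forall>i. \<bar>x $ i - y $ i\<bar> \<le> r)"
proof
  assume "sup_dist x y \<le> r"
  then show "\<forall>i. \<bar>x $ i - y $ i\<bar> \<le> r"
    using component_le_infnorm_cart[of "x - y"] by (auto simp: sup_dist_def intro: order_trans)
next
  assume "\<forall>i. \<bar>x $ i - y $ i\<bar> \<le> r"
  then show "sup_dist x y \<le> r"
    unfolding sup_dist_def infnorm_cart by (intro cSup_least) auto
qed

interpretation cube: Metric_space unit_cube sup_dist
  by (rule Metric_space_unit_cube)

lemma sup_dist_le_1: "x \<in> unit_cube \<Longrightarrow> y \<in> unit_cube \<Longrightarrow> sup_dist x y \<le> 1"
  unfolding sup_dist_le_iff by (auto simp: unit_cube_def abs_le_iff intro: order_trans[of _ 1]) (smt (verit))+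

text \<open>The uniform and the Euclidean norm are equivalent, so compactness and Borel sets may be taken in
  the Euclidean sense.\<close>

lemma mtopology_unit_cube: "cube.mtopology = top_of_set (unit_cube :: (real ^ 'n) set)"
proof -
  have "openin cube.mtopology U \<longleftrightarrow> openin (top_of_set unit_cube) U" for U :: "(real ^ 'n) set"
  proof -
    let ?c = "sqrt DIM(real ^ 'n)"
    have c: "0 < ?c" by simp
    have "(\<exists>r>0. cube.mball x r \<subseteq> U) \<longleftrightarrow> (\<exists>e>0. ball x e \<inter> unit_cube \<subseteq> U)" if "x \<in> unit_cube" for x
    proof (intro iffI; elim exE conjE)
      fix r :: real assume r: "0 < r" "cube.mball x r \<subseteq> U"
      have "ball x r \<inter> unit_cube \<subseteq> cube.mball x r"
        using that by (auto simp: dist_norm sup_dist_def intro: le_less_trans[OF infnorm_le_norm])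
      then show "\<exists>e>0. ball x e \<inter> unit_cube \<subseteq> U" using r by blast
    next
      fix e :: real assume e: "0 < e" "ball x e \<inter> unit_cube \<subseteq> U"
      have "dist x y < e" if "sup_dist x y < e / ?c" for y
      proof -
        have "?c * infnorm (x - y) < e"
          using that c by (simp add: sup_dist_def pos_less_divide_eq mult.commute)
        then show ?thesis using norm_le_infnorm[of "x - y"] by (simp add: dist_norm)
      qed
      then have "cube.mball x (e / ?c) \<subseteq> ball x e \<inter> unit_cube" by auto
      moreover have "0 < e / ?c" using e(1) c by (rule divide_pos_pos)
      ultimately show "\<exists>r>0. cube.mball x r \<subseteq> U" using e(2) by blast
    qed
    then show ?thesis unfolding cube.openin_mtopology openin_contains_ball by blast
  qed
  then show ?thesis by (simp add: topology_eq)
qed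

lemma compactin_unit_cube: "compactin cube.mtopology C \<longleftrightarrow> compact C \<and> C \<subseteq> unit_cube"
  by (auto simp: mtopology_unit_cube compactin_subtopology)

lemma measurable_metric_borel_unit_cube:
  "(\<lambda>x. x) \<in> metric_borel (unit_cube :: (real ^ 'n) set) sup_dist \<rightarrow>\<^sub>M borel"
proof (rule borel_measurableI)
  let ?O = "{U :: (real ^ 'n) set. openin cube.mtopology U}"
  have "?O \<subseteq> Pow unit_cube" using openin_subset[of cube.mtopology] by auto
  then have sets: "sets (metric_borel unit_cube sup_dist) = sigma_sets (unit_cube :: (real ^ 'n) set) ?O"
    unfolding metric_borel_def by (rule sets_measure_of)
  fix S :: "(real ^ 'n) set" assume "open S"
  then have "openin cube.mtopology (S \<inter> unit_cube)"
    unfolding mtopology_unit_cube by (auto simp: openin_open)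
  then show "(\<lambda>x. x) -` S \<inter> space (metric_borel unit_cube sup_dist) \<in> sets (metric_borel unit_cube sup_dist)"
    unfolding space_metric_borel[OF Metric_space_unit_cube] sets by (simp add: sigma_sets.Basic)
qed

definition point_dist :: "real ^ 'n \<Rightarrow> (real ^ 'n) set \<Rightarrow> real" where
  "point_dist x A = (INF y\<in>A. sup_dist x y)"

lemma semidist_point: "semidist sup_dist {x} A = point_dist x A"
  by (simp add: semidist_def point_dist_def)

lemma semidist_image: "semidist sup_dist (f ` C) A = (SUP c\<in>C. point_dist (f c) A)"
  by (simp add: semidist_def point_dist_def image_image)

lemma bdd_below_sup_dist: "bdd_below (sup_dist x ` A)"
  by (rule bdd_belowI2[of _ 0]) simp

lemma point_dist_le: "y \<in> A \<Longrightarrow> point_dist x A \<le> sup_dist x y"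
  unfolding point_dist_def by (rule cINF_lower[OF bdd_below_sup_dist])

lemma point_dist_nonneg: "A \<noteq> {} \<Longrightarrow> 0 \<le> point_dist x A"
  unfolding point_dist_def by (rule cINF_greatest) auto

lemma point_dist_le_1:
  assumes "A \<noteq> {}" "A \<subseteq> unit_cube" "x \<in> unit_cube"
  shows "point_dist x A \<le> 1"
proof -
  obtain y where "y \<in> A" using assms(1) by blast
  then have "point_dist x A \<le> sup_dist x y" "sup_dist x y \<le> 1"
    using assms by (auto intro: point_dist_le sup_dist_le_1)
  then show ?thesis by linarith
qed

lemma point_dist_triangle:
  assumes "A \<noteq> {}"
  shows "point_dist x A \<le> sup_dist x z + point_dist z A"
proof -
  have "point_dist x A - sup_dist x z \<le> point_dist z A"
    unfolding point_dist_def[of z]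
  proof (rule cINF_greatest[OF assms])
    fix y assume "y \<in> A"
    then have "point_dist x A \<le> sup_dist x y" by (rule point_dist_le)
    moreover have "sup_dist x y \<le> sup_dist x z + sup_dist z y"
      using infnorm_triangle[of "x - z" "z - y"] by (simp add: sup_dist_def)
    ultimately show "point_dist x A - sup_dist x z \<le> sup_dist z y" by linarith
  qed
  then show ?thesis by linarith
qed

lemma sup_dist_dense:
  assumes "unit_cube \<subseteq> closure D" "x \<in> unit_cube" "0 < e"
  obtains q where "q \<in> D" "sup_dist x q < e"
proof -
  obtain q where "q \<in> D" "dist q x < e"
    using assms closure_approachable[of x D] by blast
  then show ?thesis
    using that infnorm_le_norm[of "x - q"] by (force simp: sup_dist_def dist_norm norm_minus_commute)
qed

text \<open>Used for measurability: with the infimum restricted to a countable dense set, the distance of a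
  random point \<open>x\<close> to a random set \<open>A\<close> is a countable infimum of measurable functions, as only the
  distances of fixed points to \<open>A\<close> enter.\<close>

lemma point_dist_dense:
  assumes D: "unit_cube \<subseteq> closure D" and A: "A \<noteq> {}" and x: "x \<in> unit_cube"
  shows "point_dist x A = (INF q\<in>D. sup_dist x q + point_dist q A)"
proof (rule antisym)
  have "D \<noteq> {}" using D x by auto
  then show "point_dist x A \<le> (INF q\<in>D. sup_dist x q + point_dist q A)"
    by (rule cINF_greatest) (rule point_dist_triangle[OF A])
  show "(INF q\<in>D. sup_dist x q + point_dist q A) \<le> point_dist x A"
  proof (rule field_le_epsilon)
    fix e :: real assume "0 < e"
    then obtain q where q: "q \<in> D" "sup_dist x q < e / 2"
      using sup_dist_dense[OF D x, of "e / 2"] by auto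
    have bdd: "bdd_below ((\<lambda>q. sup_dist x q + point_dist q A) ` D)"
      using point_dist_nonneg[OF A] by (intro bdd_belowI2[of _ 0] add_nonneg_nonneg) auto
    have "(INF q\<in>D. sup_dist x q + point_dist q A) \<le> sup_dist x q + point_dist q A"
      by (rule cINF_lower[OF bdd q(1)])
    also have "\<dots> \<le> sup_dist x q + (sup_dist q x + point_dist x A)"
      using point_dist_triangle[OF A, of q x] by simp
    finally show "(INF q\<in>D. sup_dist x q + point_dist q A) \<le> point_dist x A + e"
      using q(2) cube.commute[of q x] by linarith
  qed
qed

lemma unit_cube_subset_if_point_dist_0:
  fixes A D :: "(real ^ 'n) set"
  assumes A: "A \<noteq> {}" "compact A" and D: "unit_cube \<subseteq> closure D"
    and zero: "\<And>q. q \<in> D \<Longrightarrow> point_dist q A = 0"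
  shows "unit_cube \<subseteq> A"
proof
  fix x :: "real ^ 'n" assume x: "x \<in> unit_cube"
  show "x \<in> A"
  proof (rule ccontr)
    assume "x \<notin> A"
    have "continuous_on A (\<lambda>y. sup_dist x y)" unfolding sup_dist_def by (intro continuous_intros)
    then obtain y where y: "y \<in> A" "\<And>z. z \<in> A \<Longrightarrow> sup_dist x y \<le> sup_dist x z"
      using continuous_attains_inf[OF A(2,1)] by blast
    have pos: "0 < sup_dist x y"
      using \<open>x \<notin> A\<close> y(1) by (auto simp: sup_dist_def infnorm_pos_lt)
    obtain q where q: "q \<in> D" "sup_dist x q < sup_dist x y"
      using sup_dist_dense[OF D x pos] by blast
    have "sup_dist x y \<le> point_dist x A"
      unfolding point_dist_def by (rule cINF_greatest[OF A(1) y(2)])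
    also have "\<dots> \<le> sup_dist x q" using point_dist_triangle[OF A(1), of x q] zero[OF q(1)] by simp
    finally show False using q(2) by simp
  qed
qed

text \<open>If, at arbitrarily late times \<open>t\<close> and with probability close to 1, the flow started at time \<open>-t\<close>
  carries some point of \<open>C\<close> to within \<open>\<rho>\<close> of \<open>p\<close> at time 0, then the attractor at time 0 is almost surely within
  \<open>2 * \<rho>\<close> of \<open>p\<close>. Attraction of \<open>C\<close> is a statement about the flow started at time 0 and the attractor seen at
  time \<open>t\<close>; since the shift preserves the measure, it holds equally for the flow started at time \<open>-t\<close>
  and the attractor at time 0, which does not depend on \<open>t\<close>.\<close>

lemma attractor_near_point_if_hit:
  fixes M :: "'w measure" and p :: "real ^ 'n"
  assumes r: "rds M \<theta> unit_cube sup_dist \<psi>"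
    and attr: "weak_cc_attractor M \<theta> unit_cube sup_dist \<psi> A"
    and p: "p \<in> unit_cube" and \<rho>: "0 < \<rho>"
    and C: "C \<noteq> {}" "countable C" "compact C" "C \<subseteq> unit_cube"
    and hit: "\<And>\<eta> T0. 0 < \<eta> \<Longrightarrow> \<exists>t\<ge>T0. \<exists>G\<in>sets M. measure M G > 1 - \<eta> \<and>
       (\<forall>\<omega>\<in>G. \<exists>c\<in>C. sup_dist p (\<psi> t (\<theta> (- t) \<omega>) c) \<le> \<rho>)"
  shows "AE \<omega> in M. point_dist p (A \<omega>) \<le> 2 * \<rho>"
proof -
  have m: "mds M \<theta>" using r by (simp add: rds_def)
  interpret prob_space M using m by (simp add: mds_def)
  have crs: "A \<omega> \<noteq> {}" "A \<omega> \<subseteq> unit_cube" if "\<omega> \<in> space M" for \<omega>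
    using attr that by (auto simp: weak_cc_attractor_def compact_random_set_def compactin_unit_cube)
  have dist_meas: "(\<lambda>\<omega>. point_dist x (A \<omega>)) \<in> borel_measurable M" if "x \<in> unit_cube" for x
    using attr that by (simp add: weak_cc_attractor_def compact_random_set_def semidist_point)
  have \<theta>: "\<theta> t \<in> M \<rightarrow>\<^sub>M M" for t
  proof -
    have "(\<lambda>\<omega>. (t, \<omega>)) \<in> M \<rightarrow>\<^sub>M (borel :: real measure) \<Otimes>\<^sub>M M" by simp
    moreover have "(\<lambda>(t, \<omega>). \<theta> t \<omega>) \<in> borel \<Otimes>\<^sub>M M \<rightarrow>\<^sub>M M" using m by (simp add: mds_def)
    ultimately show ?thesis by (auto dest: measurable_compose)
  qed
  have \<psi>: "(\<lambda>\<omega>. \<psi> t \<omega> c) \<in> borel_measurable M" if "c \<in> unit_cube" for t c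
  proof -
    have pair: "(\<lambda>\<omega>. (t, \<omega>, c)) \<in> M \<rightarrow>\<^sub>M (borel :: real measure) \<Otimes>\<^sub>M (M \<Otimes>\<^sub>M metric_borel unit_cube sup_dist)"
      using that by (intro measurable_Pair measurable_const) (auto simp: space_metric_borel[OF Metric_space_unit_cube])
    have joint: "(\<lambda>(t, \<omega>, x). \<psi> t \<omega> x)
        \<in> borel \<Otimes>\<^sub>M (M \<Otimes>\<^sub>M metric_borel unit_cube sup_dist) \<rightarrow>\<^sub>M metric_borel unit_cube sup_dist"
      using r by (simp add: rds_def)
    have "(\<lambda>\<omega>. \<psi> t \<omega> c) \<in> M \<rightarrow>\<^sub>M metric_borel unit_cube sup_dist"
      using measurable_compose[OF pair joint] by (simp only: prod.case)
    then show ?thesis by (rule measurable_compose[OF _ measurable_metric_borel_unit_cube])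
  qed
  obtain D :: "(real ^ 'n) set" where D: "countable D" "D \<subseteq> unit_cube" "unit_cube \<subseteq> closure D"
    using separable by blast
  define Z where "Z = (\<lambda>t \<omega>. semidist sup_dist (\<psi> t \<omega> ` C) (A (\<theta> t \<omega>)))"
  have pd: "(\<lambda>\<omega>. point_dist (\<psi> t \<omega> c) (A (\<theta> t \<omega>))) \<in> borel_measurable M" if "c \<in> C" for t c
  proof -
    have "(\<lambda>\<omega>. INF q\<in>D. sup_dist (\<psi> t \<omega> c) q + point_dist q (A (\<theta> t \<omega>))) \<in> borel_measurable M"
    proof (rule borel_measurable_cINF_real[OF D(1)], rule borel_measurable_add)
      fix q assume q: "q \<in> D"
      have "(\<lambda>x. sup_dist x q) \<in> borel_measurable borel"
        unfolding sup_dist_def by (intro borel_measurable_continuous_onI continuous_intros)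
      then show "(\<lambda>\<omega>. sup_dist (\<psi> t \<omega> c) q) \<in> borel_measurable M"
        using \<psi> that C(4) by (intro measurable_compose[OF \<psi>]) auto
      show "(\<lambda>\<omega>. point_dist q (A (\<theta> t \<omega>))) \<in> borel_measurable M"
        using q D(2) by (intro measurable_compose[OF \<theta> dist_meas]) auto
    qed
    moreover have "point_dist (\<psi> t \<omega> c) (A (\<theta> t \<omega>))
        = (INF q\<in>D. sup_dist (\<psi> t \<omega> c) q + point_dist q (A (\<theta> t \<omega>)))" if "\<omega> \<in> space M" for \<omega>
      using crs(1)[OF mds_space[OF m that]] rds_maps_to[OF r that] C(4) \<open>c \<in> C\<close>
      by (intro point_dist_dense[OF D(3)]) auto
    ultimately show ?thesis by (simp cong: measurable_cong)
  qed
  have bdd: "bdd_above ((\<lambda>c. point_dist (\<psi> t \<omega> c) (A (\<theta> t \<omega>))) ` C)" if "\<omega> \<in> space M" for t \<omega>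
    using crs[OF mds_space[OF m that]] rds_maps_to[OF r that] C(4)
    by (intro bdd_aboveI2[of _ _ 1] point_dist_le_1) auto
  \<comment> \<open>The definition of convergence in probability speaks of \<open>measure\<close>, which is 0 on non-measurable sets; it is informative only because \<open>Z t\<close> is measurable.\<close>
  have Z: "Z t \<in> borel_measurable M" for t
    unfolding Z_def semidist_image by (rule borel_measurable_cSUP[OF C(2) pd bdd])
  have Z_ge: "point_dist (\<psi> t \<omega> c) (A (\<theta> t \<omega>)) \<le> Z t \<omega>" if "\<omega> \<in> space M" "c \<in> C" for t \<omega> c
    unfolding Z_def semidist_image by (rule cSUP_upper[OF that(2) bdd[OF that(1)]])
  have "tends_to_0_in_probability M Z"
    unfolding Z_def using attr C by (auto simp: weak_cc_attractor_def compactin_unit_cube)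
  then have lim: "((\<lambda>t. prob {\<omega>\<in>space M. \<bar>Z t \<omega>\<bar> > \<rho>}) \<longlongrightarrow> 0) at_top"
    using \<rho> by (simp add: tends_to_0_in_probability_def)
  define N where "N = {\<omega>\<in>space M. point_dist p (A \<omega>) > 2 * \<rho>}"
  have N: "N \<in> events" unfolding N_def using dist_meas[OF p] by measurable
  have "prob N = 0"
  proof (rule ccontr)
    assume "prob N \<noteq> 0"
    then have pos: "0 < prob N / 2" by (simp add: zero_less_measure_iff)
    obtain T0 where T0: "\<And>t. t \<ge> T0 \<Longrightarrow> prob {\<omega>\<in>space M. \<bar>Z t \<omega>\<bar> > \<rho>} < prob N / 2"
      using order_tendstoD(2)[OF lim pos] by (auto simp: eventually_at_top_linorder)
    obtain t G where t: "T0 \<le> t" and G: "G \<in> events" "prob G > 1 - prob N / 2"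
      and hitG: "\<And>\<omega>. \<omega> \<in> G \<Longrightarrow> \<exists>c\<in>C. sup_dist p (\<psi> t (\<theta> (- t) \<omega>) c) \<le> \<rho>"
      using hit[OF pos, of T0] by blast
    define S where "S = {\<omega>\<in>space M. \<bar>Z t \<omega>\<bar> > \<rho>}"
    have S: "S \<in> events" unfolding S_def using Z[of t] by measurable
    have "N \<inter> G \<subseteq> \<theta> (- t) -` S \<inter> space M"
    proof
      fix \<omega> assume w: "\<omega> \<in> N \<inter> G"
      then have sp: "\<omega> \<in> space M" by (simp add: N_def)
      obtain c where c: "c \<in> C" "sup_dist p (\<psi> t (\<theta> (- t) \<omega>) c) \<le> \<rho>" using hitG w by blast
      have ret: "\<theta> t (\<theta> (- t) \<omega>) = \<omega>"
        using m sp unfolding mds_def by (metis add.right_inverse)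
      have "2 * \<rho> < point_dist p (A \<omega>)" using w by (simp add: N_def)
      also have "\<dots> \<le> sup_dist p (\<psi> t (\<theta> (- t) \<omega>) c) + point_dist (\<psi> t (\<theta> (- t) \<omega>) c) (A \<omega>)"
        by (rule point_dist_triangle[OF crs(1)[OF sp]])
      also have "\<dots> \<le> \<rho> + Z t (\<theta> (- t) \<omega>)"
        using c(2) Z_ge[OF mds_space[OF m sp] c(1), of t "- t"] ret by simp
      finally show "\<omega> \<in> \<theta> (- t) -` S \<inter> space M"
        using sp mds_space[OF m sp] by (auto simp: S_def)
    qed
    then have "prob (N \<inter> G) \<le> prob (\<theta> (- t) -` S \<inter> space M)"
      using S by (intro finite_measure_mono measurable_sets[OF \<theta>]) auto
    also have "\<dots> = measure (distr M M (\<theta> (- t))) S"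
      by (rule measure_distr[OF \<theta> S, symmetric])
    also have "\<dots> = prob S" using m by (simp add: mds_def)
    also have "\<dots> < prob N / 2" unfolding S_def by (rule T0[OF t])
    finally have "prob (N \<inter> G) < prob N / 2" .
    moreover have "prob N \<le> prob (N \<inter> G) + prob (N - G)"
    proof -
      have "N = (N \<inter> G) \<union> (N - G)" by blast
      then show ?thesis using measure_Un_le[of "N \<inter> G" M "N - G"] N G(1) by simp
    qed
    moreover have "prob (N - G) \<le> prob (space M - G)"
      using N G(1) sets.sets_into_space[OF N] by (intro finite_measure_mono) auto
    moreover have "prob (space M - G) = 1 - prob G" by (rule prob_compl[OF G(1)])
    ultimately show False using G(2) by linarith
  qed
  then have "AE \<omega> in M. \<omega> \<notin> N" using N by (simp add: prob_eq_0 AE_iff_measurable)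
  then show ?thesis by (rule AE_mp) (auto simp: N_def not_less intro!: AE_I2)
qed

section \<open>Countable compact sets that are dense near the corners\<close>

definition end_grid :: "(nat \<Rightarrow> nat) \<Rightarrow> (nat \<Rightarrow> real) \<Rightarrow> nat \<Rightarrow> real set" where
  "end_grid N \<epsilon> n = {u. \<exists>k\<le>N n. u = real k / real (N n) \<and> (u \<le> \<epsilon> n \<or> 1 - \<epsilon> n \<le> u)}"

text \<open>The midpoint serves the intervals that reach from the neighbourhood of \<open>0\<close> to that of \<open>1\<close>, the
  end points make the set closed.\<close>

definition accumulating_grid :: "(nat \<Rightarrow> nat) \<Rightarrow> (nat \<Rightarrow> real) \<Rightarrow> real set" where
  "accumulating_grid N \<epsilon> = {0, 1/2, 1} \<union> (\<Union>n. end_grid N \<epsilon> n)"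

lemma finite_end_grid: "finite (end_grid N \<epsilon> n)"
  by (rule finite_subset[of _ "(\<lambda>k. real k / real (N n)) ` {..N n}"]) (auto simp: end_grid_def)

lemma countable_accumulating_grid: "countable (accumulating_grid N \<epsilon>)"
  unfolding accumulating_grid_def by (auto intro: countable_finite finite_end_grid)

lemma accumulating_grid_subset: "accumulating_grid N \<epsilon> \<subseteq> {0..1}"
  by (auto simp: accumulating_grid_def end_grid_def divide_le_eq)

text \<open>Outside the \<open>\<epsilon> m\<close>-neighbourhoods of \<open>0\<close> and \<open>1\<close> only the finitely many finite grids with index below
  \<open>m\<close> contribute. The set is therefore the intersection of \<open>[0, 1]\<close> with closed sets \<open>E m\<close>, each consisting
  of three points, these grids and the two neighbourhoods.\<close>

lemma compact_accumulating_grid: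
  assumes \<epsilon>: "decseq \<epsilon>" "\<epsilon> \<longlonglongrightarrow> 0"
  shows "compact (accumulating_grid N \<epsilon>)"
proof -
  define E where "E m = {0, 1/2, 1} \<union> (\<Union>n<m. end_grid N \<epsilon> n) \<union> {..\<epsilon> m} \<union> {1 - \<epsilon> m..}" for m
  have "accumulating_grid N \<epsilon> = (\<Inter>m. E m) \<inter> {0..1}"
  proof (intro equalityI subsetI IntI)
    fix u assume u: "u \<in> accumulating_grid N \<epsilon>"
    then show "u \<in> {0..1}" using accumulating_grid_subset by blast
    show "u \<in> (\<Inter>m. E m)"
    proof
      fix m
      show "u \<in> E m"
      proof (cases "u \<in> {0, 1/2, 1}")
        case False
        then obtain n where n: "u \<in> end_grid N \<epsilon> n" using u by (auto simp: accumulating_grid_def)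
        show ?thesis
        proof (cases "n < m")
          case True
          then show ?thesis using n by (auto simp: E_def)
        next
          case False
          then have "\<epsilon> n \<le> \<epsilon> m" using \<epsilon>(1) by (auto simp: decseq_def)
          then show ?thesis using n by (auto simp: E_def end_grid_def)
        qed
      qed (auto simp: E_def)
    qed
  next
    fix u assume u: "u \<in> (\<Inter>m. E m) \<inter> {0..1}"
    show "u \<in> accumulating_grid N \<epsilon>"
    proof (rule ccontr)
      assume no: "u \<notin> accumulating_grid N \<epsilon>"
      then have "0 < min u (1 - u)" using u by (auto simp: accumulating_grid_def less_le)
      then obtain m where "\<epsilon> m < min u (1 - u)"
        using order_tendstoD(2)[OF \<epsilon>(2)] by (metis eventually_happens' sequentially_bot)
      moreover have "u \<in> E m" using u by blast
      ultimately show False using no by (auto simp: E_def accumulating_grid_def)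
    qed
  qed
  moreover have "closed (E m)" for m
    unfolding E_def by (intro closed_Un finite_imp_closed finite_UN_I closed_atMost closed_atLeast)
      (auto intro: finite_end_grid)
  ultimately show ?thesis by (auto intro!: closed_Int_compact)
qed

lemma grid_point_between:
  assumes x: "0 \<le> x" "x + 1 / real K < y" and y: "y \<le> 1" and K: "0 < K"
  shows "\<exists>k\<le>K. x < real k / real K \<and> real k / real K < y"
proof -
  define k where "k = nat \<lfloor>x * real K\<rfloor> + 1"
  have fl: "real (nat \<lfloor>x * real K\<rfloor>) = of_int \<lfloor>x * real K\<rfloor>" using x K by simp
  have k: "x * real K < real k" "real k \<le> x * real K + 1"
    unfolding k_def using fl floor_correct[of "x * real K"] by linarith+
  have "x * real K + 1 < y * real K" using x(2) K by (simp add: field_simps)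
  then have ky: "real k < y * real K" using k(2) by linarith
  have "y * real K \<le> real K" using y K by (simp add: mult_left_le_one_le)
  then have "k \<le> K" using ky by simp
  then show ?thesis using k(1) ky K by (intro exI[of _ k]) (simp add: field_simps)
qed

lemma accumulating_grid_between:
  assumes x: "0 \<le> x" "x + 1 / real (N n) < y" and y: "y \<le> 1" and N: "0 < N n" and \<epsilon>: "\<epsilon> n < 1/2"
    and out: "x \<le> \<epsilon> n \<or> 1 - \<epsilon> n \<le> x" "y \<le> \<epsilon> n \<or> 1 - \<epsilon> n \<le> y"
  shows "\<exists>c\<in>accumulating_grid N \<epsilon>. x < c \<and> c < y"
proof -
  obtain k where k: "k \<le> N n" "x < real k / real (N n)" "real k / real (N n) < y"
    using grid_point_between[OF x y N] by blast
  consider "y \<le> \<epsilon> n" | "1 - \<epsilon> n \<le> x" | "x \<le> \<epsilon> n" "1 - \<epsilon> n \<le> y" using out by blast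
  then show ?thesis
  proof cases
    case 3
    then show ?thesis using \<epsilon> by (intro bexI[of _ "1/2"]) (auto simp: accumulating_grid_def)
  next
    case 1
    then have "real k / real (N n) \<in> end_grid N \<epsilon> n" using k by (auto simp: end_grid_def)
    then show ?thesis using k by (auto simp: accumulating_grid_def)
  next
    case 2
    then have "real k / real (N n) \<in> end_grid N \<epsilon> n" using k by (auto simp: end_grid_def)
    then show ?thesis using k by (auto simp: accumulating_grid_def)
  qed
qed

definition cube_power :: "real set \<Rightarrow> (real ^ 'n) set" where
  "cube_power S = {z. \<forall>i. z $ i \<in> S}"

lemma countable_cube_power: "countable S \<Longrightarrow> countable (cube_power S)"
  unfolding cube_power_def by (rule countable_vector)

lemma compact_cube_power:
  assumes "compact S" "S \<subseteq> {0..1}"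
  shows "compact (cube_power S :: (real ^ 'n) set)"
proof -
  have "closed {z :: real ^ 'n. z $ i \<in> S}" for i
    using closed_vimage[OF compact_imp_closed[OF assms(1)], of "\<lambda>z. z $ i"]
    by (simp add: vimage_def continuous_intros)
  then have "closed (cube_power S :: (real ^ 'n) set)"
    unfolding cube_power_def by (rule closed_Collect_all)
  moreover have "bounded (cube_power S :: (real ^ 'n) set)"
    using assms(2) by (intro bounded_subset[OF bounded_cbox[of 0 1]]) (auto simp: cube_power_def mem_box_cart subset_eq)
  ultimately show ?thesis by (simp add: compact_eq_bounded_closed)
qed

text \<open>By continuity from above of the measure: the events that some coordinate gap is at most \<open>1 / K\<close>
  decrease to the empty set.\<close>

lemma ordered_points_separated_by_gap:
  fixes f g :: "'w \<Rightarrow> real ^ 'n"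
  assumes "prob_space M" and a: "\<And>i. (\<lambda>\<omega>. f \<omega> $ i) \<in> borel_measurable M"
    and b: "\<And>i. (\<lambda>\<omega>. g \<omega> $ i) \<in> borel_measurable M"
    and less: "\<And>\<omega> i. \<omega> \<in> space M \<Longrightarrow> f \<omega> $ i < g \<omega> $ i" and \<eta>: "0 < \<eta>"
  shows "\<exists>K::nat. 0 < K \<and> measure M {\<omega>\<in>space M. \<exists>i. g \<omega> $ i \<le> f \<omega> $ i + 1 / real K} < \<eta>"
proof -
  interpret prob_space M by fact
  define A where "A k = {\<omega>\<in>space M. \<exists>i. g \<omega> $ i \<le> f \<omega> $ i + 1 / real (Suc k)}" for k
  have "(\<lambda>k. prob (A k)) \<longlonglongrightarrow> prob (\<Inter>k. A k)"
  proof (rule finite_Lim_measure_decseq)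
    have "A k = (\<Union>i. {\<omega>\<in>space M. g \<omega> $ i \<le> f \<omega> $ i + 1 / real (Suc k)})" for k
      by (auto simp: A_def)
    moreover have "{\<omega>\<in>space M. g \<omega> $ i \<le> f \<omega> $ i + 1 / real (Suc k)} \<in> events" for i k
      using a[of i] b[of i] by measurable
    ultimately show "range A \<subseteq> events" by auto
    have "1 / real (Suc l) \<le> 1 / real (Suc k)" if "k \<le> l" for k l
      using that by (simp add: frac_le)
    then show "decseq A" unfolding decseq_def A_def by (fastforce intro: order_trans add_left_mono)
  qed
  moreover have "(\<Inter>k. A k) = {}"
  proof -
    have "\<exists>k. \<omega> \<notin> A k" if w: "\<omega> \<in> space M" for \<omega>
    proof -
      have "\<exists>k. \<forall>i. inverse (real (Suc k)) < g \<omega> $ i - f \<omega> $ i"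
      proof -
        have "finite (range (\<lambda>i. g \<omega> $ i - f \<omega> $ i))" by simp
        then have "0 < Min (range (\<lambda>i. g \<omega> $ i - f \<omega> $ i))" using less[OF w] by (subst Min_gr_iff) auto
        then obtain k where "inverse (real (Suc k)) < Min (range (\<lambda>i. g \<omega> $ i - f \<omega> $ i))"
          using reals_Archimedean by blast
        then show ?thesis by (intro exI[of _ k]) (auto simp: Min_gr_iff)
      qed
      then obtain k where "\<And>i. f \<omega> $ i + 1 / real (Suc k) < g \<omega> $ i"
        by (auto simp: inverse_eq_divide algebra_simps)
      then show ?thesis by (intro exI[of _ k]) (auto simp: A_def not_le)
    qed
    moreover have "(\<Inter>k. A k) \<subseteq> space M" by (auto simp: A_def)
    ultimately show ?thesis by blast
  qed
  ultimately have "(\<lambda>k. prob (A k)) \<longlonglongrightarrow> 0" by simp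
  from order_tendstoD(2)[OF this \<eta>] obtain k where "prob (A k) < \<eta>"
    by (metis eventually_happens' sequentially_bot)
  then show ?thesis unfolding A_def by (intro exI[of _ "Suc k"]) auto
qed

section \<open>The attractor of the inverse flow\<close>

lemma flow_strictly_increasing:
  assumes incr: "coordinatewise_increasing M \<phi>"
    and "\<omega> \<in> space M" "a \<in> unit_cube" "b \<in> unit_cube" "a $ i < b $ i"
  shows "\<phi> t \<omega> a $ i < \<phi> t \<omega> b $ i"
proof -
  obtain g where g: "strict_mono_on {0..1} (g i)" "\<And>x. x \<in> unit_cube \<Longrightarrow> \<phi> t \<omega> x = (\<chi> i. g i (x $ i))"
    using incr assms(2) unfolding coordinatewise_increasing_def by metis
  show ?thesis
    using strict_mono_onD[OF g(1), of "a $ i" "b $ i"] assms g(2) by (auto simp: unit_cube_def)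
qed

lemma inverse_flow_inverse:
  fixes t :: real
  assumes r: "rds M \<theta> E d \<psi>" and w: "\<omega> \<in> space M" and c: "c \<in> E"
  defines "z \<equiv> inverse_flow E \<theta> \<psi> t (\<theta> t \<omega>) c"
  shows "z \<in> E" "\<psi> t \<omega> z = c"
proof -
  have m: "mds M \<theta>" using r by (simp add: rds_def)
  have s: "\<theta> t \<omega> \<in> space M" by (rule mds_space[OF m w])
  have z: "z = \<psi> (- t) (\<theta> t \<omega>) c"
    unfolding z_def by (rule inverse_flow_eq[OF r s c])
  show "z \<in> E" unfolding z by (rule rds_maps_to[OF r s c])
  have ret: "\<theta> (- t) (\<theta> t \<omega>) = \<omega>"
    using m w unfolding mds_def by (metis add.left_inverse)
  have "\<psi> (t + - t) (\<theta> t \<omega>) c = \<psi> t (\<theta> (- t) (\<theta> t \<omega>)) z"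
    using r s c unfolding rds_def z by blast
  moreover have "\<psi> 0 (\<theta> t \<omega>) c = c" using r s c unfolding rds_def by blast
  ultimately show "\<psi> t \<omega> z = c" using ret by simp
qed

lemma inverse_flow_onto:
  assumes r: "rds M \<theta> E d \<psi>" and w: "\<omega> \<in> space M"
  shows "inverse_flow E \<theta> \<psi> t \<omega> ` E = E"
proof (intro equalityI subsetI)
  have m: "mds M \<theta>" using r by (simp add: rds_def)
  show "y \<in> E" if "y \<in> inverse_flow E \<theta> \<psi> t \<omega> ` E" for y
    using that rds_maps_to[OF rds_inverse_flow[OF r] w] by blast
  fix y assume y: "y \<in> E"
  have y': "\<psi> t (\<theta> (- t) \<omega>) y \<in> E"
    by (rule rds_maps_to[OF r mds_space[OF m w] y])
  have "\<psi> (- t + t) (\<theta> (- t) \<omega>) y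
      = \<psi> (- t) (\<theta> t (\<theta> (- t) \<omega>)) (\<psi> t (\<theta> (- t) \<omega>) y)"
    using r mds_space[OF m w] y unfolding rds_def by blast
  moreover have "\<theta> t (\<theta> (- t) \<omega>) = \<omega>"
    using m w unfolding mds_def by (metis add.right_inverse)
  moreover have "\<psi> 0 (\<theta> (- t) \<omega>) y = y"
    using r mds_space[OF m w] y unfolding rds_def by blast
  ultimately have "y = inverse_flow E \<theta> \<psi> t \<omega> (\<psi> t (\<theta> (- t) \<omega>) y)"
    by (simp add: inverse_flow_eq[OF r w y'])
  then show "y \<in> inverse_flow E \<theta> \<psi> t \<omega> ` E" using y' by blast
qed

lemma unit_cube_weak_cc_attractor:
  fixes M :: "(real \<Rightarrow> real ^ 'n) measure"
    and \<phi> :: "real \<Rightarrow> (real \<Rightarrow> real ^ 'n) \<Rightarrow> real ^ 'n \<Rightarrow> real ^ 'n"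
  assumes r: "rds M wiener_shift unit_cube sup_dist \<phi>"
  shows "weak_cc_attractor M (\<lambda>t. wiener_shift (- t)) unit_cube sup_dist
     (inverse_flow unit_cube wiener_shift \<phi>) (\<lambda>_. unit_cube)"
proof -
  have m: "mds M wiener_shift" using r by (simp add: rds_def)
  interpret prob_space M using m by (simp add: mds_def)
  have cube: "compact (unit_cube :: (real ^ 'n) set)" "(unit_cube :: (real ^ 'n) set) \<noteq> {}"
  proof -
    have "(unit_cube :: (real ^ 'n) set) = cbox 0 1" by (auto simp: unit_cube_def mem_box_cart)
    then show "compact (unit_cube :: (real ^ 'n) set)" by (metis compact_cbox)
    have "(0 :: real ^ 'n) \<in> unit_cube" by (simp add: unit_cube_def)
    then show "(unit_cube :: (real ^ 'n) set) \<noteq> {}" by blast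
  qed
  have zero: "point_dist x unit_cube = 0" if "x \<in> unit_cube" for x :: "real ^ 'n"
    using point_dist_le[OF that, of x] point_dist_nonneg[OF cube(2), of x]
    by (simp add: sup_dist_def infnorm_0)
  have "compact_random_set M unit_cube sup_dist (\<lambda>_. unit_cube :: (real ^ 'n) set)"
    using cube by (simp add: compact_random_set_def compactin_unit_cube)
  moreover have "strictly_invariant M (\<lambda>t. wiener_shift (- t)) (inverse_flow unit_cube wiener_shift \<phi>) (\<lambda>_. unit_cube)"
    unfolding strictly_invariant_def using inverse_flow_onto[OF r] by (auto intro!: AE_I2)
  moreover have "tends_to_0_in_probability M
      (\<lambda>t \<omega>. semidist sup_dist (inverse_flow unit_cube wiener_shift \<phi> t \<omega> ` C) unit_cube)"
    if C: "C \<noteq> {}" "C \<subseteq> unit_cube" for C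
  proof -
    have "semidist sup_dist (inverse_flow unit_cube wiener_shift \<phi> t \<omega> ` C) unit_cube = 0"
      if "\<omega> \<in> space M" for t \<omega>
    proof -
      have "point_dist (inverse_flow unit_cube wiener_shift \<phi> t \<omega> c) unit_cube = 0" if "c \<in> C" for c
        using that C(2) rds_maps_to[OF rds_inverse_flow[OF r] \<open>\<omega> \<in> space M\<close>] by (intro zero) auto
      then show ?thesis using C(1) by (simp add: semidist_image)
    qed
    then have empty: "{\<omega>\<in>space M. \<bar>semidist sup_dist (inverse_flow unit_cube wiener_shift \<phi> t \<omega> ` C) unit_cube\<bar> > \<epsilon>} = {}"
      if "0 < \<epsilon>" for t \<epsilon> using that by auto
    show ?thesis
      unfolding tends_to_0_in_probability_def
    proof (intro allI impI)
      fix \<epsilon> :: real assume "0 < \<epsilon>"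
      show "((\<lambda>t. prob {\<omega>\<in>space M. \<bar>semidist sup_dist
          (inverse_flow unit_cube wiener_shift \<phi> t \<omega> ` C) unit_cube\<bar> > \<epsilon>}) \<longlongrightarrow> 0) at_top"
        unfolding empty[OF \<open>0 < \<epsilon>\<close>] by simp
    qed
  qed
  ultimately show ?thesis by (auto simp: weak_cc_attractor_def compactin_unit_cube)
qed

context
  fixes M :: "(real \<Rightarrow> real ^ 'n) measure"
    and \<phi> :: "real \<Rightarrow> (real \<Rightarrow> real ^ 'n) \<Rightarrow> real ^ 'n \<Rightarrow> real ^ 'n"
  assumes W: "two_sided_wiener_space M"
    and r: "rds M wiener_shift unit_cube sup_dist \<phi>"
    and sol: "solution_flow M \<phi>"
    and incr: "coordinatewise_increasing M \<phi>"
begin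

text \<open>At late times \<open>t n\<close> the trajectories of \<open>a\<close> and \<open>b\<close> are likely to be within \<open>\<epsilon> n\<close> of \<open>0\<close> or \<open>1\<close> in each
  coordinate, and there they may come arbitrarily close to each other. However, they never meet, so
  some mesh \<open>1 / N n\<close> is likely to be finer than their gaps at that particular time. The set \<open>C\<close> is
  built after all times and meshes have been chosen; it is allowed to be arbitrarily dense near the
  ends because any countable compact set is attracted.\<close>

lemma ex_countable_compact_set_hitting_box:
  assumes a: "a \<in> unit_cube" and b: "b \<in> unit_cube" and ab: "\<And>i. a $ i < b $ i"
  obtains C :: "(real ^ 'n) set" where "C \<noteq> {}" "countable C" "compact C" "C \<subseteq> unit_cube"
    and "\<And>\<eta> T0. 0 < \<eta> \<Longrightarrow> \<exists>t\<ge>T0. \<exists>G\<in>sets M. measure M G > 1 - \<eta> \<and>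
      (\<forall>\<omega>\<in>G. \<exists>c\<in>C. \<forall>i. \<phi> t \<omega> a $ i < c $ i \<and> c $ i < \<phi> t \<omega> b $ i)"
proof -
  interpret prob_space M by (rule prob_space_wiener[OF W])
  define \<epsilon> :: "nat \<Rightarrow> real" where "\<epsilon> n = 1 / (real n + 3)" for n
  have \<epsilon>: "0 < \<epsilon> n" "\<epsilon> n < 1/2" for n by (auto simp: \<epsilon>_def field_simps)
  have \<epsilon>_dec: "decseq \<epsilon>" unfolding decseq_def \<epsilon>_def by (auto intro!: divide_left_mono)
  have \<epsilon>_lim: "\<epsilon> \<longlonglongrightarrow> 0" unfolding \<epsilon>_def using LIMSEQ_ignore_initial_segment[OF lim_1_over_n, of 3] by (simp add: add.commute)
  have cube: "\<phi> t \<omega> x \<in> unit_cube" if "\<omega> \<in> space M" "x \<in> unit_cube" for t \<omega> x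
    by (rule rds_maps_to[OF r that])
  define mid where "mid x i t n = {\<omega>\<in>space M. \<epsilon> n < \<phi> t \<omega> x $ i \<and> \<phi> t \<omega> x $ i < 1 - \<epsilon> n}" for x i t n
  have "\<exists>t\<ge>real n. 0 \<le> t \<and> (\<forall>x\<in>{a, b}. \<forall>i. prob (mid x i t n) < \<epsilon> n)" for n
    unfolding mid_def using a b \<epsilon>(1) by (intro flow_leaves_interior[OF W sol cube]) auto
  then obtain t where t: "\<And>n. real n \<le> t n" "\<And>n. 0 \<le> t n"
    and mid: "\<And>n x i. x \<in> {a, b} \<Longrightarrow> prob (mid x i (t n) n) < \<epsilon> n" by metis
  have meas: "(\<lambda>\<omega>. \<phi> (t n) \<omega> x $ i) \<in> borel_measurable M" if "x \<in> {a, b}" for n x i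
    using that a b t(2) by (intro solution_flow_component_measurable[OF W sol]) auto
  define close where "close n K = {\<omega>\<in>space M. \<exists>i. \<phi> (t n) \<omega> b $ i \<le> \<phi> (t n) \<omega> a $ i + 1 / real K}" for n K
  have "\<exists>K::nat. 0 < K \<and> prob (close n K) < \<epsilon> n" for n
    unfolding close_def using a b ab meas flow_strictly_increasing[OF incr] \<epsilon>(1)
    by (intro ordered_points_separated_by_gap prob_space_axioms) auto
  then obtain N :: "nat \<Rightarrow> nat" where N: "\<And>n. 0 < N n" "\<And>n. prob (close n (N n)) < \<epsilon> n" by metis
  define C :: "(real ^ 'n) set" where "C = cube_power (accumulating_grid N \<epsilon>)"
  show thesis
  proof (rule that)
    show "C \<noteq> {}"
    proof -
      have "(0 :: real ^ 'n) \<in> C" by (simp add: C_def cube_power_def accumulating_grid_def)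
      then show ?thesis by blast
    qed
    show "countable C" unfolding C_def by (intro countable_cube_power countable_accumulating_grid)
    show "compact C"
      unfolding C_def by (intro compact_cube_power compact_accumulating_grid accumulating_grid_subset \<epsilon>_dec \<epsilon>_lim)
    show "C \<subseteq> unit_cube"
      using accumulating_grid_subset[of N \<epsilon>] by (auto simp: C_def cube_power_def unit_cube_def subset_eq)
    fix \<eta> T0 :: real assume \<eta>: "0 < \<eta>"
    \<comment> \<open>One bad event for the gaps, and two for each coordinate, each of probability less than \<open>\<epsilon> n\<close>.\<close>
    let ?d = "real (2 * CARD('n) + 1)"
    have "(\<lambda>n. ?d * \<epsilon> n) \<longlonglongrightarrow> ?d * 0" by (intro tendsto_mult tendsto_const \<epsilon>_lim)
    then have "\<forall>\<^sub>F n in sequentially. ?d * \<epsilon> n < \<eta>" using \<eta> by (intro order_tendstoD(2)) auto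
    moreover have "\<forall>\<^sub>F n in sequentially. T0 \<le> real n"
      using filterlim_real_sequentially by (simp add: filterlim_at_top)
    ultimately obtain n where n: "?d * \<epsilon> n < \<eta>" "T0 \<le> real n"
      by (metis (mono_tags, lifting) eventually_conj eventually_happens' sequentially_bot)
    define bad where "bad = close n (N n) \<union> (\<Union>i. mid a i (t n) n \<union> mid b i (t n) n)"
    have mid_ev: "mid x i (t n) n \<in> events" if "x \<in> {a, b}" for x i
      unfolding mid_def using meas[OF that, of n i] by measurable
    have "close n (N n) = (\<Union>i. {\<omega>\<in>space M. \<phi> (t n) \<omega> b $ i \<le> \<phi> (t n) \<omega> a $ i + 1 / real (N n)})"
      by (auto simp: close_def)
    moreover have "{\<omega>\<in>space M. \<phi> (t n) \<omega> b $ i \<le> \<phi> (t n) \<omega> a $ i + 1 / real (N n)} \<in> events" for i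
      using meas[of a n i] meas[of b n i] by simp
    ultimately have close_ev: "close n (N n) \<in> events" by auto
    have bad: "bad \<in> events" unfolding bad_def using close_ev mid_ev by auto
    have "prob bad \<le> prob (close n (N n)) + prob (\<Union>i. mid a i (t n) n \<union> mid b i (t n) n)"
      unfolding bad_def using close_ev mid_ev by (intro measure_Un_le) auto
    also have "\<dots> \<le> prob (close n (N n)) + (\<Sum>i\<in>UNIV. prob (mid a i (t n) n \<union> mid b i (t n) n))"
      using mid_ev by (intro add_left_mono measure_UNION_le) auto
    also have "\<dots> \<le> \<epsilon> n + (\<Sum>i\<in>(UNIV :: 'n set). \<epsilon> n + \<epsilon> n)"
    proof (intro add_mono sum_mono)
      show "prob (close n (N n)) \<le> \<epsilon> n" using N(2)[of n] by simp
      fix i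
      have "prob (mid a i (t n) n \<union> mid b i (t n) n) \<le> prob (mid a i (t n) n) + prob (mid b i (t n) n)"
        using mid_ev by (intro measure_Un_le) auto
      also have "\<dots> \<le> \<epsilon> n + \<epsilon> n" using mid[of a i n] mid[of b i n] by simp
      finally show "prob (mid a i (t n) n \<union> mid b i (t n) n) \<le> \<epsilon> n + \<epsilon> n" .
    qed
    also have "\<dots> = ?d * \<epsilon> n" by (simp add: algebra_simps)
    finally have "prob bad < \<eta>" using n(1) by simp
    then have "prob (space M - bad) > 1 - \<eta>" by (simp add: prob_compl[OF bad])
    moreover have "\<exists>c\<in>C. \<forall>i. \<phi> (t n) \<omega> a $ i < c $ i \<and> c $ i < \<phi> (t n) \<omega> b $ i"
      if w: "\<omega> \<in> space M - bad" for \<omega>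
    proof -
      have "\<exists>c\<in>accumulating_grid N \<epsilon>. \<phi> (t n) \<omega> a $ i < c \<and> c < \<phi> (t n) \<omega> b $ i" for i
      proof (rule accumulating_grid_between[where n = n and N = N and \<epsilon> = \<epsilon>, OF _ _ _ N(1) \<epsilon>(2)])
        show "0 \<le> \<phi> (t n) \<omega> a $ i" "\<phi> (t n) \<omega> b $ i \<le> 1"
          using cube[of \<omega> a "t n"] cube[of \<omega> b "t n"] a b w by (auto simp: unit_cube_def)
        show "\<phi> (t n) \<omega> a $ i + 1 / real (N n) < \<phi> (t n) \<omega> b $ i"
          using w by (auto simp: bad_def close_def not_le)
        show "\<phi> (t n) \<omega> a $ i \<le> \<epsilon> n \<or> 1 - \<epsilon> n \<le> \<phi> (t n) \<omega> a $ i"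
          "\<phi> (t n) \<omega> b $ i \<le> \<epsilon> n \<or> 1 - \<epsilon> n \<le> \<phi> (t n) \<omega> b $ i"
          using w by (auto simp: bad_def mid_def not_le not_less)
      qed
      then obtain c where c: "\<And>i. c i \<in> accumulating_grid N \<epsilon>"
        "\<And>i. \<phi> (t n) \<omega> a $ i < c i \<and> c i < \<phi> (t n) \<omega> b $ i" by metis
      then show ?thesis by (intro bexI[of _ "\<chi> i. c i"]) (auto simp: C_def cube_power_def)
    qed
    ultimately show "\<exists>t\<ge>T0. \<exists>G\<in>sets M. measure M G > 1 - \<eta> \<and>
        (\<forall>\<omega>\<in>G. \<exists>c\<in>C. \<forall>i. \<phi> t \<omega> a $ i < c $ i \<and> c $ i < \<phi> t \<omega> b $ i)"
      using n(2) t(1)[of n] bad by (intro exI[of _ "t n"] conjI bexI[of _ "space M - bad"]) auto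
  qed
qed

text \<open>The box with corners \<open>a\<close> and \<open>b\<close> is the part of the \<open>\<rho>\<close>-ball around \<open>p\<close> inside the cube. Monotonicity
  of the flow turns a point of \<open>C\<close> between the images of the corners into a point of the pulled-back set
  \<open>C\<close> inside that box.\<close>

lemma attractor_near_point:
  assumes attr: "weak_cc_attractor M (\<lambda>t. wiener_shift (- t)) unit_cube sup_dist
      (inverse_flow unit_cube wiener_shift \<phi>) A"
    and p: "p \<in> unit_cube" and \<rho>: "0 < \<rho>"
  shows "AE \<omega> in M. point_dist p (A \<omega>) \<le> 2 * \<rho>"
proof -
  define a b :: "real ^ 'n" where "a = (\<chi> i. max 0 (p $ i - \<rho>))" and "b = (\<chi> i. min 1 (p $ i + \<rho>))"
  have pi: "0 \<le> p $ i" "p $ i \<le> 1" for i using p by (auto simp: unit_cube_def)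
  have cube: "a \<in> unit_cube" "b \<in> unit_cube"
    using pi \<rho> by (auto simp: a_def b_def unit_cube_def intro: order_trans less_imp_le)
       (smt (verit) pi)+
  have ab: "a $ i < b $ i" for i using pi[of i] \<rho> by (auto simp: a_def b_def)
  obtain C :: "(real ^ 'n) set" where C: "C \<noteq> {}" "countable C" "compact C" "C \<subseteq> unit_cube"
    and hit: "\<And>\<eta> T0. 0 < \<eta> \<Longrightarrow> \<exists>t\<ge>T0. \<exists>G\<in>sets M. measure M G > 1 - \<eta> \<and>
      (\<forall>\<omega>\<in>G. \<exists>c\<in>C. \<forall>i. \<phi> t \<omega> a $ i < c $ i \<and> c $ i < \<phi> t \<omega> b $ i)"
    using ex_countable_compact_set_hitting_box[OF cube ab] by blast
  show ?thesis
  proof (rule attractor_near_point_if_hit[OF rds_inverse_flow[OF r] attr p \<rho> C])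
    fix \<eta> T0 :: real assume "0 < \<eta>"
    then obtain t G where t: "T0 \<le> t" and G: "G \<in> sets M" "measure M G > 1 - \<eta>"
      and hitG: "\<And>\<omega>. \<omega> \<in> G \<Longrightarrow> \<exists>c\<in>C. \<forall>i. \<phi> t \<omega> a $ i < c $ i \<and> c $ i < \<phi> t \<omega> b $ i"
      using hit[of \<eta> T0] by blast
    have "\<exists>c\<in>C. sup_dist p (inverse_flow unit_cube wiener_shift \<phi> t (wiener_shift (- (- t)) \<omega>) c) \<le> \<rho>"
      if wG: "\<omega> \<in> G" for \<omega>
    proof -
      have w: "\<omega> \<in> space M" using wG G(1) sets.sets_into_space by blast
      obtain c where c: "c \<in> C" "\<And>i. \<phi> t \<omega> a $ i < c $ i" "\<And>i. c $ i < \<phi> t \<omega> b $ i" using hitG[OF wG] by blast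
      define z where "z = inverse_flow unit_cube wiener_shift \<phi> t (wiener_shift t \<omega>) c"
      have z: "z \<in> unit_cube" "\<phi> t \<omega> z = c"
        unfolding z_def using inverse_flow_inverse[OF r w, of c t] c(1) C(4) by blast+
      have "a $ i \<le> z $ i" for i
        using flow_strictly_increasing[OF incr w z(1) cube(1), of i t] c(2)[of i] z(2) by force
      moreover have "z $ i \<le> b $ i" for i
        using flow_strictly_increasing[OF incr w cube(2) z(1), of i t] c(3)[of i] z(2) by force
      ultimately have "\<bar>p $ i - z $ i\<bar> \<le> \<rho>" for i
        by (simp add: a_def b_def abs_le_iff) (smt (verit))
      then have "sup_dist p z \<le> \<rho>" by (simp add: sup_dist_le_iff)
      then show ?thesis using c(1) by (auto simp: z_def)
    qed
    then show "\<exists>t\<ge>T0. \<exists>G\<in>sets M. measure M G > 1 - \<eta> \<and>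
      (\<forall>\<omega>\<in>G. \<exists>c\<in>C. sup_dist p (inverse_flow unit_cube wiener_shift \<phi> t (wiener_shift (- (- t)) \<omega>) c) \<le> \<rho>)"
      using t G by blast
  qed
qed

lemma attractor_contains_unit_cube:
  assumes attr: "weak_cc_attractor M (\<lambda>t. wiener_shift (- t)) unit_cube sup_dist
      (inverse_flow unit_cube wiener_shift \<phi>) A"
  shows "AE \<omega> in M. unit_cube \<subseteq> A \<omega>"
proof -
  obtain D :: "(real ^ 'n) set" where D: "countable D" "D \<subseteq> unit_cube" "unit_cube \<subseteq> closure D"
    using separable by blast
  have "AE \<omega> in M. \<forall>p\<in>D. \<forall>k::nat. point_dist p (A \<omega>) \<le> 2 * (1 / real (Suc k))"
    using D(1,2) attr by (intro AE_ball_countable' AE_all_countable[THEN iffD2] allI attractor_near_point) auto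
  with AE_space show ?thesis
  proof eventually_elim
    case (elim \<omega>)
    have A: "A \<omega> \<noteq> {}" "compact (A \<omega>)"
      using attr elim(1) by (auto simp: weak_cc_attractor_def compact_random_set_def compactin_unit_cube)
    have "point_dist p (A \<omega>) = 0" if "p \<in> D" for p
    proof (rule antisym)
      show "point_dist p (A \<omega>) \<le> 0"
      proof (rule LIMSEQ_le_const)
        show "(\<lambda>k. 2 * (1 / real (Suc k))) \<longlonglongrightarrow> 0" using tendsto_mult[OF tendsto_const[of 2] LIMSEQ_Suc[OF lim_1_over_n]] by simp
      qed (use elim(2) that in blast)
      show "0 \<le> point_dist p (A \<omega>)" by (rule point_dist_nonneg[OF A(1)])
    qed
    then show ?case by (rule unit_cube_subset_if_point_dist_0[OF A D(3)])
  qed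
qed

end

theorem theorem3p4:
  fixes M :: "(real \<Rightarrow> real ^ 'n) measure"
    and \<phi> :: "real \<Rightarrow> (real \<Rightarrow> real ^ 'n) \<Rightarrow> real ^ 'n \<Rightarrow> real ^ 'n"
  assumes "two_sided_wiener_space M"
    and "rds M wiener_shift unit_cube sup_dist \<phi>"
    and "jointly_continuous M unit_cube sup_dist \<phi>"
    and "solution_flow M \<phi>"
    and "coordinatewise_increasing M \<phi>"
  shows "minimal_weak_cc_attractor M (\<lambda>t. wiener_shift (- t)) unit_cube sup_dist
           (inverse_flow unit_cube wiener_shift \<phi>) (\<lambda>_. unit_cube)"
  unfolding minimal_weak_cc_attractor_def
  using unit_cube_weak_cc_attractor[OF assms(2)]
    attractor_contains_unit_cube[OF assms(1,2,4,5)] by blast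

end
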